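(* Let $\beta\geqslant2$ and $n\geqslant1$ be integers and let $\mu_k=2-2\cos(2\pi k/\beta)$, $k=1,\ldots,\beta-1$, be the non-zero eigenvalues of the Laplacian on the $\beta$-cycle. (i) If $\beta\geqslant3$, the number of spanning trees in the $n$-th power graph $\boldsymbol{C}^n_{\beta n}$ of the $\beta n$-cycle is \begin{align*} \tau(\boldsymbol{C}^n_{\beta n})&=\frac{2^{\beta(n+1)}}{(2\beta)^2}n^{\beta n-2}\left(1+\frac{1}{2n}\right)^{\beta n}\big(1-(2n+1)^{-\beta}\big)^n\\ &\times\prod_{k=1}^{\lceil\beta/2\rceil-1}\sin^2\left(\frac{\pi(n+1)k}{\beta}-n\arcsin\left(\frac{n+1}{\sqrt{4n^2/\mu_k+2n+1}}\right)\right). \end{align*} If $\beta=2$, it is $$\tau(\boldsymbol{C}^n_{2n})=(2n)^{2n-2}(1+1/n)^n.$$ (ii) If $\beta\geqslant3$, the number of spanning trees in the $(n-1)$-th power graph $\boldsymbol{C}^{n-1}_{\beta n}$ of the $\beta n$-cycle is \begin{align*} \tau(\boldsymbol{C}^{n-1}_{\beta n})&=\frac{2^{\beta(n+1)}}{(2\beta)^2}n^{\beta n-2}\left(1-\frac{1}{2n}\right)^{\beta n}\big|(-1)^\beta-(2n-1)^{-\beta}\big|^n\\ &\times\prod_{k=1}^{\lceil\beta/2\rceil-1}\sin^2\left(\frac{\pi(n-1)k}{\beta}-n\arcsin\left(\frac{n-1}{\sqrt{4n^2/\mu_k-(2n-1)}}\right)\right). \end{align*} If $\beta=2$, it is $$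\tau(\boldsymbol{C}^{n-1}_{2n})=(2n)^{2n-2}(1-1/n)^n.$$
   Context: The $r$-th power graph $\boldsymbol{C}^r_N$ of the $N$-cycle is the undirected circulant graph $C^{1,2,\ldots,r}_N$ generated by the first $r$ consecutive integers: its vertex set is $\mathbb{Z}/N\mathbb{Z}$, and each vertex $v$ is joined to $v+m$ and $v-m$ modulo $N$ for every $m\in\{1,\ldots,r\}$. Edges are counted with multiplicity so that the Laplacian is $\Delta f(x)=\sum_{m=1}^{r}\big(2f(x)-f(x+m)-f(x-m)\big)$, with eigenvalues $2r-2\sum_{m=1}^{r}\cos(2\pi km/N)$, $k=0,\ldots,N-1$; in particular, in $\boldsymbol{C}^n_{2n}$ the vertices $v$ and $v+n$ are joined by two parallel edges. (For $\beta\geqslant 3$ and $r\in\{n-1,n\}$ the graph $\boldsymbol{C}^r_{\beta n}$ has no multiple edges.) For $r=0$ the graph has no edges. $\tau(G)$ denotes the number of spanning trees of $G$ (parallel edges being distinguished); by the matrix tree theorem it is $\frac{1}{|V(G)|}\prod_{k=1}^{|V(G)|-1}\lambda_k$, where $\lambda_1,\ldots,\lambda_{|V(G)|-1}$ are the Laplacian eigenvalues other than one copy of the eigenvalue $0$. $\lceil x\rceil$ is the smallest integer greater than or equal to $x$; empty products equal $1$. *)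

theory Defs
  imports Complex_Main
begin

text \<open>
  Undirected multigraphs: edges are labels, so parallel edges are distinct elements of
  \<open>edges G\<close>, and \<open>ends G e\<close> is the set of endpoints of the edge \<open>e\<close>
  (a singleton if \<open>e\<close> is a loop).
\<close>

record ('v, 'e) multigraph =
  vertices :: "'v set"
  edges :: "'e set"
  ends :: "'e \<Rightarrow> 'v set"

definition adjacency :: "('v, 'e) multigraph \<Rightarrow> 'v rel" where
  "adjacency G = {(u, v). \<exists>e\<in>edges G. ends G e = {u, v}}"

definition is_connected :: "('v, 'e) multigraph \<Rightarrow> bool" where
  "is_connected G \<longleftrightarrow>
     vertices G \<noteq> {} \<and> (\<forall>u\<in>vertices G. \<forall>v\<in>vertices G. (u, v) \<in> (adjacency G)\<^sup>*)"

text \<open>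
  A cycle \<open>v\<^sub>0 e\<^sub>0 v\<^sub>1 e\<^sub>1 \<dots> v\<^sub>l\<^sub>-\<^sub>1 e\<^sub>l\<^sub>-\<^sub>1 v\<^sub>0\<close> has
  pairwise distinct vertices and pairwise distinct edges. A loop is a cycle of length 1 and
  two parallel edges form a cycle of length 2.
\<close>

definition is_cycle :: "('v, 'e) multigraph \<Rightarrow> 'v list \<Rightarrow> 'e list \<Rightarrow> bool" where
  "is_cycle G vs es \<longleftrightarrow>
     es \<noteq> [] \<and> length vs = length es \<and> distinct vs \<and> distinct es \<and>
     set vs \<subseteq> vertices G \<and> set es \<subseteq> edges G \<and>
     (\<forall>i<length es. ends G (es ! i) = {vs ! i, vs ! (Suc i mod length vs)})"

definition is_tree :: "('v, 'e) multigraph \<Rightarrow> bool" where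
  "is_tree G \<longleftrightarrow> is_connected G \<and> (\<nexists>vs es. is_cycle G vs es)"

text \<open>
  A spanning tree has all the vertices of \<open>G\<close>, so it is represented by its edge set;
  trees that differ only by exchanging parallel edges are distinct.
\<close>

definition spanning_trees :: "('v, 'e) multigraph \<Rightarrow> 'e set set" where
  "spanning_trees G = {T. T \<subseteq> edges G \<and> is_tree (G\<lparr>edges := T\<rparr>)}"

definition \<tau> :: "('v, 'e) multigraph \<Rightarrow> nat" where
  "\<tau> G = card (spanning_trees G)"

text \<open>
  The circulant graph on \<open>\<int>/N\<int>\<close>, represented by the residues \<open>{0..<N}\<close>,
  with generators \<open>S\<close>. For each vertex \<open>v\<close> and each \<open>m \<in> S\<close> there is exactly one
  edge \<open>(v, m)\<close>, joining \<open>v\<close> to \<open>v + m\<close>; the edge from \<open>v\<close> to \<open>v - m\<close> is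
  \<open>(v - m, m)\<close>. Every vertex thus has degree \<open>2 * card S\<close>. If \<open>N = 2 * m\<close>, then
  \<open>(v, m)\<close> and \<open>(v + m, m)\<close> are two parallel edges.
\<close>

definition circulant_graph :: "nat \<Rightarrow> nat set \<Rightarrow> (nat, nat \<times> nat) multigraph" where
  "circulant_graph N S =
     \<lparr>vertices = {0..<N}, edges = {0..<N} \<times> S, ends = (\<lambda>(v, m). {v, (v + m) mod N})\<rparr>"

definition power_graph :: "nat \<Rightarrow> nat \<Rightarrow> (nat, nat \<times> nat) multigraph" where
  "power_graph r N = circulant_graph N {1..r}"

text \<open>
  For \<open>1 \<le> k < \<beta>\<close> these are the non-zero eigenvalues of the Laplacian
  \<open>f \<mapsto> (\<lambda>x. 2 * f x - f (x + 1) - f (x - 1))\<close> of the \<open>\<beta>\<close>-cycle.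
\<close>

definition cycle_eigenvalue :: "nat \<Rightarrow> nat \<Rightarrow> real" where
  "cycle_eigenvalue \<beta> k = 2 - 2 * cos (2 * pi * real k / real \<beta>)"

end

theory Submission
  imports Defs "HOL-Library.FuncSet" "Jordan_Normal_Form.Determinant"
begin

text \<open>
  Matrix tree theorem: expanding the determinant of the reduced Laplacian row by row gives a sum
  over the maps that send each non-root vertex to an incident edge. Such a map contributes \<open>1\<close>
  if following the edges always leads to the root, and \<open>0\<close> otherwise; the contributing maps are
  the spanning trees oriented towards the root.

  Product of the eigenvalues: let \<open>N = \<beta> * n\<close> and \<open>2 * r + 1 = 2 * n + \<sigma>\<close> with
  \<open>\<sigma> = 1\<close> or \<open>\<sigma> = -1\<close>. With \<open>\<theta> = \<pi> * k / N\<close>, the \<open>k\<close>-th eigenvalue times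
  \<open>sin \<theta>\<close> is \<open>(2 * r + 1) * sin \<theta> - sin ((2 * r + 1) * \<theta>)\<close>. The angle
  \<open>(2 * r + 1) * \<theta>\<close> is congruent to \<open>2 * x + \<sigma> * \<theta>\<close> modulo \<open>2 * \<pi>\<close>, where
  \<open>x = \<pi> * j / \<beta>\<close> depends only on the residue \<open>j\<close> of \<open>k\<close> modulo \<open>\<beta>\<close>. Hence this
  expression is a single sine wave \<open>R * sin (\<theta> + \<sigma> * (x - \<psi>))\<close> whose amplitude and phase
  depend only on \<open>j\<close>, and the product over a residue class is evaluated by the product formula for
  \<open>sin (n * y)\<close>. Here \<open>R\<close> is the distance of \<open>1 + 2 * \<sigma> * n\<close> from a \<open>\<beta>\<close>-th root of
  unity, so the product of the amplitudes is explicit too.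
\<close>

subsection \<open>Spanning trees as rooted parent maps\<close>

lemma adjacency_sym: "(u, v) \<in> adjacency G \<Longrightarrow> (v, u) \<in> adjacency G"
  by (auto simp: adjacency_def insert_commute)

lemma adjacency_rtrancl_sym:
  assumes "(u, v) \<in> (adjacency G)\<^sup>*"
  shows "(v, u) \<in> (adjacency G)\<^sup>*"
  using assms by (meson adjacency_sym sym_def sym_rtrancl)

text \<open>Loop erasure, prepending one vertex at a time: if the new vertex already lies on the
  path, the part before it is dropped instead.\<close>

lemma connected_simple_path:
  assumes "(u, v) \<in> (adjacency G)\<^sup>*"
  obtains vs es where "vs \<noteq> []" "hd vs = u" "last vs = v" "distinct vs" "length vs = Suc (length es)"
    "set es \<subseteq> edges G" "\<And>i. i < length es \<Longrightarrow> ends G (es ! i) = {vs ! i, vs ! Suc i}"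
proof -
  define P where "P u vs es \<longleftrightarrow> vs \<noteq> [] \<and> hd vs = u \<and> last vs = v \<and> distinct vs \<and>
    length vs = Suc (length es) \<and> set es \<subseteq> edges G \<and>
    (\<forall>i<length es. ends G (es ! i) = {vs ! i, vs ! Suc i})" for u vs es
  have "\<exists>vs es. P u vs es"
    using assms
  proof (induction rule: converse_rtrancl_induct)
    case base
    have "P v [v] []"
      by (simp add: P_def)
    then show ?case by blast
  next
    case (step u w)
    then obtain vs es where *: "P w vs es"
      by blast
    show ?case
    proof (cases "u \<in> set vs")
      case True
      then obtain i where i: "i < length vs" "vs ! i = u"
        by (auto simp: in_set_conv_nth)
      have "P u (drop i vs) (drop i es)"
        using * i by (auto simp: P_def hd_drop_conv_nth dest: in_set_dropD)
      then show ?thesis by blast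
    next
      case False
      from step(1) obtain e where e: "e \<in> edges G" "ends G e = {u, w}"
        by (auto simp: adjacency_def)
      have "P u (u # vs) (e # es)"
        using * e False by (auto simp: P_def nth_Cons hd_conv_nth split: nat.splits)
      then show ?thesis by blast
    qed
  qed
  then show thesis
    using that unfolding P_def by blast
qed

text \<open>A simple path from \<open>u\<close> to \<open>v\<close> that avoids \<open>e\<close> is
  closed up by \<open>e\<close>. If \<open>u = v\<close>, the path is trivial and \<open>e\<close>
  alone is a cycle of length 1.\<close>

lemma cycle_if_connected_without_edge:
  assumes ends: "\<And>e. e \<in> edges G \<Longrightarrow> ends G e \<subseteq> vertices G"
    and e: "e \<in> edges G" "ends G e = {u, v}"
    and path: "(u, v) \<in> (adjacency (G\<lparr>edges := edges G - {e}\<rparr>))\<^sup>*"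
  shows "\<exists>vs es. is_cycle G vs es"
proof -
  obtain vs es where p: "vs \<noteq> []" "hd vs = u" "last vs = v" "distinct vs"
      "length vs = Suc (length es)" "set es \<subseteq> edges G - {e}"
    and step: "\<And>i. i < length es \<Longrightarrow> ends G (es ! i) = {vs ! i, vs ! Suc i}"
    by (rule connected_simple_path[OF path]) (use that in simp)
  \<comment> \<open>Equal edges would join the same pair of consecutive vertices, and on a simple
    path such a pair determines the position.\<close>
  have "distinct es"
    unfolding distinct_conv_nth
  proof (intro allI impI notI)
    fix i j assume ij: "i < length es" "j < length es" "i \<noteq> j" "es ! i = es ! j"
    then have "{vs ! i, vs ! Suc i} = {vs ! j, vs ! Suc j}"
      using step by metis
    then have "{i, Suc i} = {j, Suc j}"
      using p ij by (auto simp: doubleton_eq_iff nth_eq_iff_index_eq)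
    then show False
      using \<open>i \<noteq> j\<close> by (auto simp: doubleton_eq_iff)
  qed
  moreover have "vs ! i \<in> vertices G" if "i < length vs" for i
  proof (cases "i < length es")
    case True
    then show ?thesis
      using step[of i] ends[of "es ! i"] p by (auto simp: subset_iff)
  next
    case False
    then have "vs ! i = v"
      using that p by (auto simp: last_conv_nth less_Suc_eq)
    then show ?thesis
      using ends e by blast
  qed
  then have "set vs \<subseteq> vertices G"
    by (auto simp: in_set_conv_nth)
  \<comment> \<open>At the last index the successor wraps around to \<open>hd vs = u\<close>, where
    \<open>e\<close> closes the cycle.\<close>
  moreover have "ends G ((es @ [e]) ! i) = {vs ! i, vs ! (Suc i mod length vs)}"
    if "i < Suc (length es)" for i
  proof (cases "i < length es")
    case True
    then have "Suc i mod length vs = Suc i"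
      using p(5) by simp
    then show ?thesis
      using step[OF True] True by (simp add: nth_append)
  next
    case False
    then have "i = length es"
      using that by simp
    then show ?thesis
      using p e by (simp add: nth_append last_conv_nth hd_conv_nth insert_commute)
  qed
  ultimately have "is_cycle G vs (es @ [e])"
    using p e by (auto simp: is_cycle_def)
  then show ?thesis by blast
qed

text \<open>For a loop at \<open>v\<close> this is \<open>v\<close> itself; if \<open>v\<close> is
  not an endpoint of \<open>e\<close>, the value is unspecified.\<close>

definition opposite :: "('v, 'e) multigraph \<Rightarrow> 'e \<Rightarrow> 'v \<Rightarrow> 'v" where
  "opposite G e v = (THE w. ends G e = {v, w})"

lemma opposite_eqI: "ends G e = {v, w} \<Longrightarrow> opposite G e v = w"
  unfolding opposite_def by (rule the_equality) (auto simp: doubleton_eq_iff)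

definition incident :: "('v, 'e) multigraph \<Rightarrow> 'v \<Rightarrow> 'e set" where
  "incident G v = {e \<in> edges G. v \<in> ends G e}"

text \<open>The extensional product makes a map determined by its values off the root, so that
  counting maps is meaningful.\<close>

definition parent_maps :: "('v, 'e) multigraph \<Rightarrow> 'v \<Rightarrow> ('v \<Rightarrow> 'e) set" where
  "parent_maps G r = (\<Pi>\<^sub>E v \<in> vertices G - {r}. incident G v)"

text \<open>
  Orienting a spanning tree towards the root \<open>r\<close> turns it into the map that sends every
  other vertex to its outgoing edge; the decreasing \<open>h\<close> excludes directed cycles.
\<close>

definition rooted :: "('v, 'e) multigraph \<Rightarrow> 'v \<Rightarrow> ('v \<Rightarrow> 'e) \<Rightarrow> bool" where
  "rooted G r f \<longleftrightarrow> (\<exists>h :: 'v \<Rightarrow> nat. \<forall>v \<in> vertices G - {r}. h (opposite G (f v) v) < h v)"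

section \<open>Spanning trees correspond to rooted parent maps\<close>

locale finite_multigraph =
  fixes G :: "('v, 'e) multigraph"
  assumes finite_vertices: "finite (vertices G)"
    and finite_edges: "finite (edges G)"
    and ends_ex: "e \<in> edges G \<Longrightarrow> \<exists>u\<in>vertices G. \<exists>v\<in>vertices G. ends G e = {u, v}"
begin

lemma ends_subset: "e \<in> edges G \<Longrightarrow> ends G e \<subseteq> vertices G"
  using ends_ex by fastforce

lemma ends_opposite:
  assumes "e \<in> incident G v"
  shows "ends G e = {v, opposite G e v}"
proof -
  from assms obtain x y where "ends G e = {x, y}" "v \<in> {x, y}"
    using ends_ex[of e] unfolding incident_def by auto
  then obtain w where "ends G e = {v, w}"
    by (metis insertE insert_commute singletonD)
  then show ?thesis
    using opposite_eqI by metis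
qed

lemma opposite_in_vertices: "e \<in> incident G v \<Longrightarrow> opposite G e v \<in> vertices G"
  using ends_opposite[of e v] ends_subset[of e] unfolding incident_def by auto

context
  fixes r assumes root: "r \<in> vertices G"
begin

lemma parent_map_ends:
  assumes "f \<in> parent_maps G r" "v \<in> vertices G - {r}"
  shows "ends G (f v) = {v, opposite G (f v) v}" "opposite G (f v) v \<in> vertices G"
    "f v \<in> edges G"
proof -
  have "f v \<in> incident G v"
    using assms unfolding parent_maps_def by (rule PiE_mem)
  then show "ends G (f v) = {v, opposite G (f v) v}" "opposite G (f v) v \<in> vertices G"
    "f v \<in> edges G"
    by (fact ends_opposite, fact opposite_in_vertices, simp add: incident_def)
qed

text \<open>Induction on the height: the edge chosen at a vertex leads to a lower one, and the
  descent can only end at the root.\<close>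

lemma rooted_image_connected:
  assumes f: "f \<in> parent_maps G r" "rooted G r f"
  shows "is_connected (G\<lparr>edges := f ` (vertices G - {r})\<rparr>)" (is "is_connected ?T")
proof -
  obtain h :: "_ \<Rightarrow> nat" where h: "\<And>v. v \<in> vertices G - {r} \<Longrightarrow> h (opposite G (f v) v) < h v"
    using f unfolding rooted_def by blast
  have reach: "(v, r) \<in> (adjacency ?T)\<^sup>*" if "v \<in> vertices G" for v
    using that
  proof (induction "h v" arbitrary: v rule: less_induct)
    case less
    show ?case
    proof (cases "v = r")
      case False
      then have v: "v \<in> vertices G - {r}"
        using less by simp
      have "(v, opposite G (f v) v) \<in> adjacency ?T"
        using parent_map_ends[OF f(1) v] v by (auto simp: adjacency_def)
      then show ?thesis
        using less(1)[OF h[OF v] parent_map_ends(2)[OF f(1) v]]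
        by (rule converse_rtrancl_into_rtrancl)
    qed simp
  qed
  show ?thesis
    unfolding is_connected_def
  proof (intro conjI ballI)
    fix u v assume "u \<in> vertices ?T" "v \<in> vertices ?T"
    then have "u \<in> vertices G" "v \<in> vertices G"
      by simp_all
    then show "(u, v) \<in> (adjacency ?T)\<^sup>*"
      by (intro rtrancl_trans[OF reach adjacency_rtrancl_sym[OF reach]])
  qed (use root in auto)
qed

text \<open>
  On a cycle, a vertex \<open>v\<close> of maximal height would have two distinct edges, each equal to the
  outgoing edge of \<open>v\<close>.
\<close>

lemma rooted_image_acyclic:
  assumes f: "f \<in> parent_maps G r" "rooted G r f"
  shows "\<not> is_cycle (G\<lparr>edges := f ` (vertices G - {r})\<rparr>) vs es" (is "\<not> is_cycle ?T vs es")
proof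
  assume "is_cycle ?T vs es"
  then have c: "es \<noteq> []" "length vs = length es" "distinct vs" "distinct es"
    "set vs \<subseteq> vertices G" "set es \<subseteq> f ` (vertices G - {r})"
    and step: "\<And>i. i < length es \<Longrightarrow> ends G (es ! i) = {vs ! i, vs ! (Suc i mod length vs)}"
    by (simp_all add: is_cycle_def)
  obtain h :: "_ \<Rightarrow> nat" where h: "\<And>v. v \<in> vertices G - {r} \<Longrightarrow> h (opposite G (f v) v) < h v"
    using f unfolding rooted_def by blast
  define m where "m = Max ((\<lambda>i. h (vs ! i)) ` {..<length es})"
  have ne: "{..<length es} \<noteq> {}"
    using c by auto
  have "m \<in> (\<lambda>i. h (vs ! i)) ` {..<length es}"
    unfolding m_def using ne by (intro Max_in) auto
  then obtain i where i: "i < length es" "h (vs ! i) = m"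
    by auto
  have max: "h (vs ! j) \<le> h (vs ! i)" if "j < length es" for j
    unfolding i(2) m_def using that by (intro Max_ge) auto
  \<comment> \<open>Each edge of the cycle is the outgoing edge of one of its endpoints. At
    \<open>vs ! i\<close> it must be that of \<open>vs ! i\<close>, since otherwise it would lead
    from \<open>vs ! j\<close> down to a vertex of maximal height.\<close>
  have outgoing: "es ! k = f (vs ! i)" if k: "k < length es" "j < length es" "ends G (es ! k) = {vs ! i, vs ! j}" for j k
  proof -
    from c k obtain v where v: "v \<in> vertices G - {r}" "es ! k = f v"
      using nth_mem by blast
    then have "{v, opposite G (f v) v} = {vs ! i, vs ! j}"
      using parent_map_ends(1)[OF f(1) v(1)] k by simp
    then show ?thesis
      using h[OF v(1)] max[OF k(2)] v(2) by (auto simp: doubleton_eq_iff)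
  qed
  \<comment> \<open>The cyclic predecessor of \<open>i\<close>, so that \<open>es ! k\<close> is the
    edge by which the cycle enters \<open>vs ! i\<close>.\<close>
  define k where "k = (if i = 0 then length es - 1 else i - 1)"
  have k: "k < length es" "Suc k mod length es = i"
    using i c(1) by (auto simp: k_def)
  have "Suc i mod length es < length es"
    using c(1) by simp
  then have "es ! i = f (vs ! i)"
    using outgoing[OF i(1)] step[OF i(1)] c(2) by simp
  moreover have "es ! k = f (vs ! i)"
    by (rule outgoing[OF k(1) k(1)]) (use step[OF k(1)] k(2) c(2) in \<open>simp add: insert_commute\<close>)
  \<comment> \<open>Only a cycle of length 1 allows this. Its edge is a loop, so the height of
    \<open>v\<close> would have to be smaller than itself.\<close>
  ultimately have "k = i"
    using nth_eq_iff_index_eq[OF c(4) k(1) i(1)] by simp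
  then have "Suc i mod length es = i"
    using k(2) by simp
  then have loop: "ends G (es ! i) = {vs ! i}"
    using step[OF i(1)] c(2) by simp
  from c i obtain v where v: "v \<in> vertices G - {r}" "es ! i = f v"
    using nth_mem by blast
  then have "opposite G (f v) v = v"
    using parent_map_ends(1)[OF f(1) v(1)] loop by auto
  then show False
    using h[OF v(1)] by simp
qed

lemma rooted_image_spanning_tree:
  assumes f: "f \<in> parent_maps G r" "rooted G r f"
  shows "f ` (vertices G - {r}) \<in> spanning_trees G"
  using rooted_image_connected[OF f] rooted_image_acyclic[OF f] parent_map_ends(3)[OF f(1)]
  unfolding spanning_trees_def is_tree_def by auto

text \<open>
  If \<open>f\<close> and \<open>g\<close> orient the same tree differently, take a vertex \<open>v\<close> of maximal height where
  they differ: \<open>g\<close> leads from \<open>v\<close> to a child \<open>w\<close> of \<open>v\<close> with respect to \<open>f\<close>, and as \<open>w\<close> is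
  higher, \<open>g\<close> leads back to \<open>v\<close>.
\<close>

lemma inj_on_rooted_image:
  "inj_on (\<lambda>f. f ` (vertices G - {r})) {f \<in> parent_maps G r. rooted G r f}"
proof (rule inj_onI)
  fix f g
  assume fg: "f \<in> {f \<in> parent_maps G r. rooted G r f}" "g \<in> {f \<in> parent_maps G r. rooted G r f}"
    and same: "f ` (vertices G - {r}) = g ` (vertices G - {r})"
  then have f: "f \<in> parent_maps G r" "rooted G r f" and g: "g \<in> parent_maps G r" "rooted G r g"
    by simp_all
  obtain h :: "_ \<Rightarrow> nat" where h: "\<And>v. v \<in> vertices G - {r} \<Longrightarrow> h (opposite G (f v) v) < h v"
    using f unfolding rooted_def by blast
  obtain h' :: "_ \<Rightarrow> nat" where h': "\<And>v. v \<in> vertices G - {r} \<Longrightarrow> h' (opposite G (g v) v) < h' v"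
    using g unfolding rooted_def by blast
  define D where "D = {v \<in> vertices G - {r}. f v \<noteq> g v}"
  have "D = {}"
  proof (rule ccontr)
    assume "D \<noteq> {}"
    have "finite D"
      using finite_vertices by (auto simp: D_def)
    then have "Max (h ` D) \<in> h ` D"
      using \<open>D \<noteq> {}\<close> by (intro Max_in) auto
    then obtain v where v: "v \<in> D" "h v = Max (h ` D)"
      by auto
    have max: "h w \<le> h v" if "w \<in> D" for w
      unfolding v(2) using that \<open>finite D\<close> by (intro Max_ge) auto
    have v': "v \<in> vertices G - {r}" "f v \<noteq> g v"
      using v by (auto simp: D_def)
    then obtain w where w: "w \<in> vertices G - {r}" "g v = f w"
      using same by (metis imageE imageI)
    then have "w \<noteq> v"
      using v' by auto
    have ends: "{v, opposite G (g v) v} = {w, opposite G (f w) w}"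
      using parent_map_ends(1)[OF f(1) w(1)] parent_map_ends(1)[OF g(1) v'(1)] w(2) by simp
    then have parents: "opposite G (g v) v = w" "opposite G (f w) w = v"
      using \<open>w \<noteq> v\<close> by (auto simp: doubleton_eq_iff)
    then have "w \<notin> D"
      using max[of w] h[OF w(1)] by auto
    then have "f w = g w"
      using w by (auto simp: D_def)
    then show False
      using h'[OF w(1)] h'[OF v'(1)] parents by simp
  qed
  then have "f v = g v" if "v \<in> vertices G - {r}" for v
    using that by (auto simp: D_def)
  then show "f = g"
    by (rule PiE_ext[OF f(1)[unfolded parent_maps_def] g(1)[unfolded parent_maps_def]])
qed

text \<open>Each vertex chooses an edge of \<open>T\<close> that shortens the distance to
  \<open>r\<close>. The chosen edges already connect all vertices, so any further edge of
  \<open>T\<close> would close a cycle.\<close>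

lemma spanning_tree_rooted_image:
  assumes T: "T \<in> spanning_trees G"
  shows "\<exists>f \<in> parent_maps G r. rooted G r f \<and> f ` (vertices G - {r}) = T"
proof -
  let ?T = "G\<lparr>edges := T\<rparr>"
  have sub: "T \<subseteq> edges G" and conn: "is_connected ?T" and acyclic: "\<nexists>vs es. is_cycle ?T vs es"
    using T by (auto simp: spanning_trees_def is_tree_def)
  \<comment> \<open>The distance to \<open>r\<close> inside \<open>T\<close>; it also serves as the
    height.\<close>
  define d where "d v = (LEAST n. (v, r) \<in> adjacency ?T ^^ n)" for v
  have "\<exists>e. e \<in> T \<and> e \<in> incident G v \<and> d (opposite G e v) < d v"
    if v: "v \<in> vertices G - {r}" for v
  proof -
    have "(v, r) \<in> (adjacency ?T)\<^sup>*"
      using conn v root by (auto simp: is_connected_def)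
    then have dv: "(v, r) \<in> adjacency ?T ^^ d v"
      unfolding d_def rtrancl_power by (rule LeastI_ex)
    then obtain m where m: "d v = Suc m"
      using v by (cases "d v") auto
    then obtain w where w: "(v, w) \<in> adjacency ?T" "(w, r) \<in> adjacency ?T ^^ m"
      using dv by (metis relpow_Suc_E2)
    have "d w \<le> m"
      unfolding d_def using w(2) by (rule Least_le)
    then have "d w < d v"
      using m by simp
    moreover obtain e where "e \<in> T" "ends G e = {v, w}"
      using w(1) by (auto simp: adjacency_def)
    ultimately show ?thesis
      using sub opposite_eqI[of G e v w] by (auto simp: incident_def)
  qed
  then obtain f0 where f0: "\<And>v. v \<in> vertices G - {r} \<Longrightarrow>
      f0 v \<in> T \<and> f0 v \<in> incident G v \<and> d (opposite G (f0 v) v) < d v"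
    by metis
  define f where "f = restrict f0 (vertices G - {r})"
  have f: "f \<in> parent_maps G r"
    using f0 unfolding f_def parent_maps_def by auto
  have "rooted G r f"
    using f0 unfolding f_def rooted_def by auto
  moreover have "f ` (vertices G - {r}) = T"
  proof (rule ccontr)
    assume neq: "f ` (vertices G - {r}) \<noteq> T"
    have imT: "f ` (vertices G - {r}) \<subseteq> T"
      using f0 by (auto simp: f_def)
    then obtain e where e: "e \<in> T" "e \<notin> f ` (vertices G - {r})"
      using neq by auto
    then obtain u v where uv: "u \<in> vertices G" "v \<in> vertices G" "ends G e = {u, v}"
      using ends_ex sub by blast
    have "(u, v) \<in> (adjacency (G\<lparr>edges := f ` (vertices G - {r})\<rparr>))\<^sup>*"
      using rooted_image_connected[OF f \<open>rooted G r f\<close>] uv by (auto simp: is_connected_def)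
    moreover have "adjacency (G\<lparr>edges := f ` (vertices G - {r})\<rparr>) \<subseteq> adjacency (G\<lparr>edges := T - {e}\<rparr>)"
      using imT e by (fastforce simp: adjacency_def)
    ultimately have "(u, v) \<in> (adjacency (G\<lparr>edges := T - {e}\<rparr>))\<^sup>*"
      using rtrancl_mono by blast
    moreover have "ends ?T e \<subseteq> vertices ?T" if "e \<in> edges ?T" for e
      using that sub ends_subset[of e] by auto
    ultimately show False
      using cycle_if_connected_without_edge[of ?T e u v] acyclic e uv by auto
  qed
  ultimately show ?thesis
    using f by blast
qed

theorem \<tau>_eq_card_rooted: "\<tau> G = card {f \<in> parent_maps G r. rooted G r f}"
proof -
  have "(\<lambda>f. f ` (vertices G - {r})) ` {f \<in> parent_maps G r. rooted G r f} = spanning_trees G"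
    using rooted_image_spanning_tree by (auto dest!: spanning_tree_rooted_image)
  then show ?thesis
    unfolding \<tau>_def using card_image[OF inj_on_rooted_image] by simp
qed

end

lemma finite_parent_maps: "finite (parent_maps G r)"
  unfolding parent_maps_def
  by (intro finite_PiE) (use finite_vertices finite_edges in \<open>auto simp: incident_def\<close>)

end

subsection \<open>The matrix tree theorem\<close>

text \<open>
  If \<open>p\<close> has a directed cycle, then the indicator of the vertices from which \<open>p\<close> does not lead
  to \<open>0\<close> is in the kernel. Otherwise only the identity contributes to the Leibniz formula.
\<close>

lemma det_functional_graph:
  fixes p :: "nat \<Rightarrow> nat"
  assumes N: "N > 0" and p: "\<And>i. i \<in> {0<..<N} \<Longrightarrow> p i < N"
  shows "det (mat N N (\<lambda>(i, j). if i = 0 then of_bool (j = 0) else of_bool (j = i) - of_bool (j = p i)))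
    = (of_bool (\<exists>h :: nat \<Rightarrow> nat. \<forall>i\<in>{0<..<N}. h (p i) < h i) :: 'a :: field)" (is "det ?M = _")
proof (cases "\<exists>h :: nat \<Rightarrow> nat. \<forall>i\<in>{0<..<N}. h (p i) < h i")
  case True
  then obtain h :: "nat \<Rightarrow> nat" where h: "\<And>i. i \<in> {0<..<N} \<Longrightarrow> h (p i) < h i"
    by blast
  have M: "?M \<in> carrier_mat N N"
    by simp
  have zero: "signof \<sigma> * (\<Prod>i = 0..<N. ?M $$ (i, \<sigma> i)) = 0"
    if \<sigma>: "\<sigma> permutes {0..<N}" "\<sigma> \<noteq> id" for \<sigma>
  proof (rule ccontr)
    assume "signof \<sigma> * (\<Prod>i = 0..<N. ?M $$ (i, \<sigma> i)) \<noteq> 0"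
    then have nz: "?M $$ (i, \<sigma> i) \<noteq> 0" if "i < N" for i
      using that by auto
    have img: "\<sigma> i < N" if "i < N" for i
      using \<sigma>(1) that permutes_in_image[of \<sigma> "{0..<N}" i] by auto
    have step: "\<sigma> i = p i \<and> 0 < i" if "i < N" "\<sigma> i \<noteq> i" for i
      using nz[OF that(1)] img[OF that(1)] that by (auto split: if_splits)
    \<comment> \<open>A moved point \<open>i\<close> of maximal height has a moved preimage
      \<open>j\<close>, and \<open>p j = \<sigma> j = i\<close> gives
      \<open>h i < h j\<close>.\<close>
    define D where "D = {i \<in> {0..<N}. \<sigma> i \<noteq> i}"
    have "D \<noteq> {}"
      using \<sigma> unfolding D_def permutes_def by (auto simp: fun_eq_iff)
    moreover have "finite D"
      by (simp add: D_def)
    ultimately have "Max (h ` D) \<in> h ` D"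
      by (intro Max_in) auto
    then obtain i where i: "i \<in> D" "h i = Max (h ` D)"
      by auto
    obtain j where j: "j < N" "\<sigma> j = i"
      using permutes_image[OF \<sigma>(1)] i(1) unfolding D_def
      by (metis (no_types, lifting) atLeastLessThan_iff imageE mem_Collect_eq)
    have "j \<in> D"
      using i(1) j permutes_inj[OF \<sigma>(1)] by (auto simp: D_def dest: injD)
    then have "h j \<le> h i"
      unfolding i(2) using \<open>finite D\<close> by (intro Max_ge) auto
    moreover have "h i < h j"
      using h[of j] step[of j] j \<open>j \<in> D\<close> by (auto simp: D_def)
    ultimately show False
      by simp
  qed
  have diag: "?M $$ (i, i) = 1" if "i < N" for i
    using that h[of i] by (cases "i = 0") auto
  have "det ?M = (\<Sum>\<sigma> | \<sigma> permutes {0..<N}. signof \<sigma> * (\<Prod>i = 0..<N. ?M $$ (i, \<sigma> i)))"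
    by (rule det_def'[OF M])
  also have "\<dots> = (\<Sum>\<sigma>\<in>{id}. signof \<sigma> * (\<Prod>i = 0..<N. ?M $$ (i, \<sigma> i)))"
    by (rule sum.mono_neutral_right) (use zero permutes_id in \<open>auto simp: finite_permutations\<close>)
  also have "\<dots> = 1"
    using diag by (simp add: sign_id)
  finally show ?thesis
    by (simp only: eqTrueI[OF True] of_bool_eq)
next
  case False
  \<comment> \<open>\<open>q\<close> makes \<open>0\<close> absorbing, so \<open>R i\<close> says
    that iterating \<open>p\<close> from \<open>i\<close> reaches \<open>0\<close>. If this held
    everywhere, the number of steps would be a height function.\<close>
  define q where "q i = (if i = 0 then 0 else p i)" for i
  define R where "R i \<longleftrightarrow> (\<exists>n. (q ^^ n) i = 0)" for i
  have "\<exists>i<N. \<not> R i"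
  proof (rule ccontr)
    assume "\<not> (\<exists>i<N. \<not> R i)"
    then have R: "\<exists>n. (q ^^ n) i = 0" if "i < N" for i
      using that by (auto simp: R_def)
    define h where "h i = (LEAST n. (q ^^ n) i = 0)" for i
    have "h (p i) < h i" if i: "i \<in> {0<..<N}" for i
    proof -
      have hi: "(q ^^ h i) i = 0"
        unfolding h_def by (rule LeastI_ex[of "\<lambda>n. (q ^^ n) i = 0"]) (use R[of i] i in simp)
      then obtain m where m: "h i = Suc m"
        using i by (cases "h i") auto
      then have "(q ^^ m) (p i) = 0"
        using hi i by (simp add: funpow_swap1 q_def)
      then have "h (p i) \<le> m"
        unfolding h_def by (rule Least_le)
      then show ?thesis
        using m by simp
    qed
    then show False
      using False by blast
  qed
  then obtain k where k: "k < N" "\<not> R k"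
    by blast
  have R0: "R 0"
    unfolding R_def by (rule exI[of _ 0]) simp
  \<comment> \<open>\<open>R\<close> is constant along \<open>p\<close>, which makes the rows
    \<open>i > 0\<close> annihilate the indicator \<open>w\<close>; row \<open>0\<close> does so by
    \<open>R0\<close>.\<close>
  have Rp: "R (p i) \<longleftrightarrow> R i" if "i > 0" for i
  proof -
    have "R (q i) \<longleftrightarrow> R i"
    proof
      assume "R (q i)"
      then obtain n where "(q ^^ n) (q i) = 0"
        by (auto simp: R_def)
      then have "(q ^^ Suc n) i = 0"
        by (simp add: funpow_swap1)
      then show "R i"
        unfolding R_def by blast
    next
      assume "R i"
      then obtain n where n: "(q ^^ n) i = 0"
        by (auto simp: R_def)
      have "(q ^^ n) (q i) = q ((q ^^ n) i)"
        by (simp only: funpow_swap1)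
      also have "\<dots> = 0"
        unfolding n by (simp add: q_def)
      finally have "(q ^^ n) (q i) = 0" .
      then show "R (q i)"
        unfolding R_def by blast
    qed
    then show ?thesis
      using that by (simp add: q_def)
  qed
  define w where "w = vec N (\<lambda>i. of_bool (\<not> R i) :: 'a)"
  have "w \<in> carrier_vec N"
    by (simp add: w_def)
  moreover have "w \<noteq> 0\<^sub>v N"
  proof
    assume "w = 0\<^sub>v N"
    then have "w $ k = 0\<^sub>v N $ k"
      by simp
    then show False
      using k by (simp add: w_def)
  qed
  moreover have "?M *\<^sub>v w = 0\<^sub>v N"
  proof (rule eq_vecI)
    fix i assume "i < dim_vec (0\<^sub>v N)"
    then have i: "i < N"
      by simp
    show "(?M *\<^sub>v w) $ i = 0\<^sub>v N $ i"
    proof (cases "i = 0")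
      case True
      have "(?M *\<^sub>v w) $ i = (\<Sum>j = 0..<N. of_bool (j = 0) * w $ j)"
        using i True by (simp add: scalar_prod_def w_def)
      also have "\<dots> = w $ 0"
        using N by (simp add: of_bool_def if_distrib[of "\<lambda>x. x * _"] sum.delta cong: if_cong)
      finally show ?thesis
        using i True R0 by (simp add: w_def)
    next
      case False
      have "(?M *\<^sub>v w) $ i = (\<Sum>j = 0..<N. (of_bool (j = i) - of_bool (j = p i)) * w $ j)"
        using i False by (simp add: scalar_prod_def w_def)
      also have "\<dots> = (\<Sum>j = 0..<N. if j = i then w $ j else 0) - (\<Sum>j = 0..<N. if j = p i then w $ j else 0)"
        unfolding sum_subtractf[symmetric] by (intro sum.cong) auto
      also have "\<dots> = w $ i - w $ p i"
        using i p[of i] False by (simp add: sum.delta)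
      finally show ?thesis
        using i p[of i] False Rp[of i] by (simp add: w_def)
    qed
  qed simp
  ultimately have "det ?M = 0"
    by (subst det_0_iff_vec_prod_zero_field[of _ N]) (simp, blast)
  then show ?thesis
    by (simp only: False simp_thms of_bool_eq)
qed

text \<open>Instead of deleting the row and column of the root \<open>0\<close>, row
  \<open>0\<close> is replaced by a unit vector: the determinant is the same minor and the dimension
  stays \<open>N\<close>. Loops contribute 0.\<close>

definition reduced_laplacian :: "(nat, 'e) multigraph \<Rightarrow> nat \<Rightarrow> 'a :: field mat" where
  "reduced_laplacian G N = mat N N (\<lambda>(i, j). if i = 0 then of_bool (j = 0)
     else \<Sum>e\<in>incident G i. of_bool (j = i) - of_bool (j = opposite G e i))"

theorem matrix_tree:
  fixes G :: "(nat, 'e) multigraph"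
  assumes G: "finite_multigraph G" and V: "vertices G = {0..<N}" and N: "N > 0"
  shows "det (reduced_laplacian G N :: 'a :: field mat) = of_nat (\<tau> G)"
proof -
  interpret finite_multigraph G by (rule G)
  have root: "0 \<in> vertices G"
    using V N by simp
  define M :: "(nat \<Rightarrow> 'e) \<Rightarrow> 'a mat" where
    "M f = mat N N (\<lambda>(i, j). if i = 0 then of_bool (j = 0)
      else of_bool (j = i) - of_bool (j = opposite G (f i) i))" for f
  have V0: "vertices G - {0} = {0<..<N}"
    unfolding V by auto
  have split: "{0..<N} = insert 0 {0<..<N}"
    using N by auto
  \<comment> \<open>Row \<open>0\<close> is the same for all maps and is split off; in the other
    rows a product of sums over incident edges becomes a sum over choices of one edge per
    vertex.\<close>
  have expand: "(\<Prod>i = 0..<N. reduced_laplacian G N $$ (i, \<sigma> i)) =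
      (\<Sum>f\<in>parent_maps G 0. \<Prod>i = 0..<N. M f $$ (i, \<sigma> i))" if "\<sigma> permutes {0..<N}" for \<sigma>
  proof -
    have \<sigma>: "\<sigma> i < N" if "i < N" for i
      using that permutes_in_image[OF \<open>\<sigma> permutes _\<close>, of i] by auto
    have "(\<Prod>i = 0..<N. reduced_laplacian G N $$ (i, \<sigma> i)) = of_bool (\<sigma> 0 = 0) *
      (\<Prod>i\<in>{0<..<N}. \<Sum>e\<in>incident G i. of_bool (\<sigma> i = i) - of_bool (\<sigma> i = opposite G e i) :: 'a)"
      unfolding split using \<sigma> N by (subst prod.insert) (auto simp: reduced_laplacian_def intro!: prod.cong)
    also have "\<dots> = of_bool (\<sigma> 0 = 0) * (\<Sum>f\<in>parent_maps G 0.
       \<Prod>i\<in>{0<..<N}. of_bool (\<sigma> i = i) - of_bool (\<sigma> i = opposite G (f i) i))"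
      unfolding parent_maps_def V0
      by (subst prod_sum_PiE) (use finite_edges in \<open>auto simp: incident_def\<close>)
    also have "\<dots> = (\<Sum>f\<in>parent_maps G 0. of_bool (\<sigma> 0 = 0) *
       (\<Prod>i\<in>{0<..<N}. of_bool (\<sigma> i = i) - of_bool (\<sigma> i = opposite G (f i) i)))"
      by (rule sum_distrib_left)
    also have "\<dots> = (\<Sum>f\<in>parent_maps G 0. \<Prod>i = 0..<N. M f $$ (i, \<sigma> i))"
      unfolding split using \<sigma> N
      by (intro sum.cong refl, subst prod.insert) (auto simp: M_def intro!: prod.cong)
    finally show ?thesis .
  qed
  have "det (reduced_laplacian G N :: 'a mat) =
      (\<Sum>\<sigma> | \<sigma> permutes {0..<N}. signof \<sigma> * (\<Prod>i = 0..<N. reduced_laplacian G N $$ (i, \<sigma> i)))"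
    by (rule det_def') (simp add: reduced_laplacian_def)
  also have "\<dots> = (\<Sum>\<sigma> | \<sigma> permutes {0..<N}. \<Sum>f\<in>parent_maps G 0.
      signof \<sigma> * (\<Prod>i = 0..<N. M f $$ (i, \<sigma> i)))"
    by (intro sum.cong refl) (simp add: expand sum_distrib_left)
  also have "\<dots> = (\<Sum>f\<in>parent_maps G 0. \<Sum>\<sigma> | \<sigma> permutes {0..<N}.
      signof \<sigma> * (\<Prod>i = 0..<N. M f $$ (i, \<sigma> i)))"
    by (rule sum.swap)
  also have "\<dots> = (\<Sum>f\<in>parent_maps G 0. det (M f))"
    by (intro sum.cong refl det_def'[symmetric]) (simp add: M_def)
  also have "\<dots> = (\<Sum>f\<in>parent_maps G 0. of_bool (rooted G 0 f))"
  proof (intro sum.cong refl)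
    fix f assume f: "f \<in> parent_maps G 0"
    have "opposite G (f i) i < N" if "i \<in> {0<..<N}" for i
      using parent_map_ends(2)[OF root f, of i] that V by auto
    then show "det (M f) = of_bool (rooted G 0 f)"
      unfolding M_def rooted_def V0 by (rule det_functional_graph[OF N])
  qed
  also have "\<dots> = (\<Sum>f\<in>{f \<in> parent_maps G 0. rooted G 0 f}. 1)"
    using finite_parent_maps by (intro sum.mono_neutral_cong_right) auto
  also have "\<dots> = of_nat (\<tau> G)"
    using \<tau>_eq_card_rooted[OF root] by simp
  finally show ?thesis .
qed

subsection \<open>Circulant graphs\<close>

lemma mat_mult_mat:
  "mat n n f * mat n n g = mat n n (\<lambda>(i, k). \<Sum>j<n. f (i, j) * g (j, k) :: 'a :: comm_ring_1)"
  by (rule eq_matI) (auto simp: scalar_prod_def atLeast0LessThan)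

lemma finite_multigraph_circulant:
  assumes "N > 0" "finite S"
  shows "finite_multigraph (circulant_graph N S)"
  by standard (use assms in \<open>auto simp: circulant_graph_def\<close>)

text \<open>The edges at \<open>i\<close> are \<open>(i, m)\<close> and \<open>(i - m, m)\<close>
  modulo \<open>N\<close>. These families are disjoint even if \<open>N = 2 * m\<close>, where both
  edges have the same other endpoint and both are counted.\<close>

lemma sum_incident_circulant:
  fixes g :: "nat \<Rightarrow> 'a :: comm_monoid_add"
  assumes "finite S" "S \<subseteq> {0<..<N}" "i < N"
  shows "(\<Sum>e\<in>incident (circulant_graph N S) i. g (opposite (circulant_graph N S) e i)) =
    (\<Sum>m\<in>S. g ((i + m) mod N) + g ((i + (N - m)) mod N))"
proof -
  define G where "G = circulant_graph N S"
  have G: "edges G = {0..<N} \<times> S" "\<And>v m. ends G (v, m) = {v, (v + m) mod N}"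
    by (auto simp: G_def circulant_graph_def)
  define A where "A = (\<lambda>m. (i, m)) ` S"
  define B where "B = (\<lambda>m. ((i + (N - m)) mod N, m)) ` S"
  have source: "((i + (N - m)) mod N + m) mod N = i" if "m \<in> S" for m
  proof -
    have "((i + (N - m)) mod N + m) mod N = (i + (N - m) + m) mod N"
      by (simp add: mod_add_left_eq)
    also have "i + (N - m) + m = i + N"
      using that assms by auto
    finally show ?thesis
      using assms by simp
  qed
  have shift: "(i + (N - m)) mod N \<noteq> i" if "m \<in> S" for m
  proof -
    have "m < N" "0 < m"
      using that assms by auto
    then show ?thesis
      using assms(3) by (cases "m \<le> i") (auto simp: mod_if)
  qed
  have inc: "incident G i = A \<union> B"
  proof (intro equalityI subsetI)
    fix e assume "e \<in> incident G i"
    then obtain v m where e: "e = (v, m)" "v < N" "m \<in> S" "i = v \<or> i = (v + m) mod N"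
      by (auto simp: incident_def G)
    then have m: "m < N"
      using assms by auto
    show "e \<in> A \<union> B"
    proof (cases "i = v")
      case False
      then have "(i + (N - m)) mod N = (v + m + (N - m)) mod N"
        using e(4) by (simp add: mod_add_left_eq)
      also have "\<dots> = v"
        using e(2) m by simp
      finally show ?thesis
        using e by (auto simp: B_def)
    qed (use e in \<open>auto simp: A_def\<close>)
  next
    fix e assume "e \<in> A \<union> B"
    then show "e \<in> incident G i"
      using assms source by (auto simp: incident_def G A_def B_def)
  qed
  have disj: "A \<inter> B = {}"
    using shift unfolding A_def B_def by fastforce
  have opA: "opposite G (i, m) i = (i + m) mod N" for m
    by (rule opposite_eqI) (simp add: G)
  have opB: "opposite G ((i + (N - m)) mod N, m) i = (i + (N - m)) mod N" if "m \<in> S" for m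
    by (rule opposite_eqI) (simp add: G source[OF that] insert_commute)
  have "(\<Sum>e\<in>incident G i. g (opposite G e i)) =
      (\<Sum>e\<in>A. g (opposite G e i)) + (\<Sum>e\<in>B. g (opposite G e i))"
    unfolding inc using assms(1) disj by (intro sum.union_disjoint) (auto simp: A_def B_def)
  also have "(\<Sum>e\<in>A. g (opposite G e i)) = (\<Sum>m\<in>S. g ((i + m) mod N))"
    unfolding A_def by (subst sum.reindex) (auto simp: inj_on_def opA)
  also have "(\<Sum>e\<in>B. g (opposite G e i)) = (\<Sum>m\<in>S. g ((i + (N - m)) mod N))"
    unfolding B_def by (subst sum.reindex) (auto simp: inj_on_def opB)
  finally show ?thesis
    by (simp add: G_def sum.distrib)
qed

lemma root_of_unity_mod:
  fixes N :: nat
  assumes "N > 0"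
  shows "cis (2 * pi * real (i mod N) / real N) = cis (2 * pi * real i / real N)"
proof -
  have "real i = real (i mod N) + real N * real (i div N)"
    by (metis mod_mult_div_eq of_nat_add of_nat_mult)
  then have "2 * pi * real i / real N = 2 * pi * real (i mod N) / real N + 2 * pi * real (i div N)"
    using assms by (simp add: field_simps)
  then show ?thesis
    by (simp add: cis_mult[symmetric] cis_multiple_2pi)
qed

text \<open>Orthogonality of the characters of the cyclic group: for \<open>i \<noteq> j\<close> the
  ratio is a root of unity other than 1 and the geometric sum vanishes.\<close>

lemma sum_powers_root_of_unity_ratio:
  assumes "i < N" "j < N"
  shows "(\<Sum>k<N. (cis (2 * pi * real i / real N) / cis (2 * pi * real j / real N)) ^ k) =
    (if i = j then of_nat N else 0)"
proof (cases "i = j")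
  case False
  define z where "z = cis (2 * pi * real i / real N) / cis (2 * pi * real j / real N)"
  have N: "N > 0"
    using assms by simp
  have "cis (2 * pi * real i / real N) \<noteq> cis (2 * pi * real j / real N)"
    using bij_betw_imp_inj_on[OF Complex.bij_betw_roots_unity[OF N]] assms False by (auto dest: inj_onD)
  then have "z \<noteq> 1"
    by (simp add: z_def)
  moreover have "z ^ N = 1"
    using N cis_multiple_2pi[of "real i"] cis_multiple_2pi[of "real j"]
    by (simp add: z_def power_divide Complex.DeMoivre)
  ultimately show ?thesis
    using False geometric_sum[of z N] by (simp add: z_def)
qed simp

theorem \<tau>_circulant:
  assumes N: "N > 0" and S: "finite S" "S \<subseteq> {0<..<N}"
  shows "real N * real (\<tau> (circulant_graph N S)) =
    (\<Prod>k\<in>{0<..<N}. \<Sum>m\<in>S. 2 - 2 * cos (2 * pi * real k * real m / real N))"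
proof -
  define G where "G = circulant_graph N S"
  define e where "e i = cis (2 * pi * real i / real N)" for i :: nat
  define lam where "lam k = (\<Sum>m\<in>S. 2 - 2 * cos (2 * pi * real k * real m / real N))" for k :: nat
  have e0: "e 0 = 1"
    by (simp add: e_def)
  have lam0: "lam 0 = 0"
    by (simp add: lam_def)
  have e_swap: "e i ^ k = e k ^ i" for i k
    by (simp add: e_def Complex.DeMoivre mult_ac)
  have e_mod: "e (i mod N) = e i" for i
    unfolding e_def using N by (rule root_of_unity_mod)
  have e_add: "e (i + j) = e i * e j" for i j
    by (simp add: e_def cis_mult add_divide_distrib ring_distribs)
  have e_N: "e N = 1"
    using N by (simp add: e_def)
  have e_minus: "e (N - m) = inverse (e m)" if "m \<in> S" for m
  proof -
    have "e (N - m) * e m = 1"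
      using that S e_N by (subst e_add[symmetric]) (auto simp: subset_iff)
    then show ?thesis
      by (metis inverse_unique mult.commute)
  qed
  have e_cos: "e m ^ k + inverse (e m) ^ k = of_real (2 * cos (2 * pi * real k * real m / real N))" for m k
    by (simp add: e_def Complex.DeMoivre complex_eq_iff mult_ac)
  have sum_e: "(\<Sum>i<N. e i ^ k) = (if k = 0 then of_nat N else 0)" if "k < N" for k
    using sum_powers_root_of_unity_ratio[OF that N] e_swap[of _ k] by (simp add: e_def)
  define F where "F = mat N N (\<lambda>(i, k). e i ^ k)"
  \<comment> \<open>Up to the factor \<open>N\<close> this is the inverse of \<open>F\<close>, so
    \<open>det F\<close> is non-zero and can be cancelled at the end.\<close>
  define F' where "F' = mat N N (\<lambda>(k, j). inverse (e j) ^ k)"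
  have "F * F' = mat N N (\<lambda>(i, j). if i = j then of_nat N else 0)"
    unfolding F_def F'_def mat_mult_mat
    using sum_powers_root_of_unity_ratio
    by (intro eq_matI) (auto simp: e_def divide_inverse power_mult_distrib)
  also have "\<dots> = of_nat N \<cdot>\<^sub>m 1\<^sub>m N"
    by (intro eq_matI) auto
  finally have "det (F * F') = of_nat N ^ N"
    by simp
  moreover have "det (F * F') = det F * det F'"
    by (rule det_mult[of _ N]) (simp_all add: F_def F'_def)
  ultimately have F: "det F \<noteq> 0"
    using N by auto
  text \<open>
    \<open>F\<close> diagonalizes the Laplacian, up to the modified row: with the triangular matrices below,
    \<open>X * (L * F) = U * (F * D)\<close>, where \<open>D\<close> carries the eigenvalues except that \<open>1\<close>
    replaces the eigenvalue \<open>0\<close>. Comparing determinants gives the claim.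
  \<close>
  define L :: "complex mat" where "L = reduced_laplacian G N"
  define A1 where "A1 = mat N N (\<lambda>(i, k). if i = 0 then 1 else e i ^ k * of_real (lam k))"
  define A2 where "A2 = mat N N (\<lambda>(i, k). e i ^ k * of_real (lam k) + 1)"
  \<comment> \<open>The ones in row \<open>0\<close> make \<open>F * D\<close> add 1 to every entry,
    because column \<open>0\<close> of \<open>F\<close> consists of ones.\<close>
  define D where "D = mat N N (\<lambda>(i, k). (if i = k then of_real (lam k) else 0) + (if i = 0 then 1 else 0) :: complex)"
  \<comment> \<open>\<open>X\<close> multiplies row \<open>0\<close> by \<open>N\<close> and adds
    the old row \<open>0\<close> to every other row; \<open>U\<close> replaces row \<open>0\<close>
    by the sum of all rows.\<close>
  define X :: "complex mat" where
    "X = mat N N (\<lambda>(i, j). if j = 0 then (if i = 0 then of_nat N else 1) else if i = j then 1 else 0)"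
  define U :: "complex mat" where "U = mat N N (\<lambda>(i, j). if i = 0 \<or> i = j then 1 else 0)"
  have "L * F = A1"
  proof -
    have "(\<Sum>j<N. (\<Sum>d\<in>incident G i. of_bool (j = i) - of_bool (j = opposite G d i)) * e j ^ k) =
        e i ^ k * of_real (lam k)" if i: "i < N" for i k
    proof -
      have opp: "opposite G d i < N" if "d \<in> incident G i" for d
        using finite_multigraph.opposite_in_vertices[OF finite_multigraph_circulant[OF N S(1)] that[unfolded G_def]]
        by (simp add: G_def circulant_graph_def)
      have "(\<Sum>j<N. (\<Sum>d\<in>incident G i. of_bool (j = i) - of_bool (j = opposite G d i)) * e j ^ k) =
          (\<Sum>d\<in>incident G i. \<Sum>j<N. (of_bool (j = i) - of_bool (j = opposite G d i)) * e j ^ k)"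
        unfolding sum_distrib_right by (rule sum.swap)
      also have "\<dots> = (\<Sum>d\<in>incident G i. e i ^ k - e (opposite G d i) ^ k)"
      proof (intro sum.cong refl)
        fix d assume d: "d \<in> incident G i"
        have "(\<Sum>j<N. (of_bool (j = i) - of_bool (j = opposite G d i)) * e j ^ k) =
           (\<Sum>j<N. if j = i then e j ^ k else 0) - (\<Sum>j<N. if j = opposite G d i then e j ^ k else 0)"
          unfolding sum_subtractf[symmetric] by (intro sum.cong) auto
        also have "\<dots> = e i ^ k - e (opposite G d i) ^ k"
          using i opp[OF d] by (simp add: sum.delta)
        finally show "(\<Sum>j<N. (of_bool (j = i) - of_bool (j = opposite G d i)) * e j ^ k) = \<dots>" .
      qed
      also have "\<dots> = (\<Sum>m\<in>S. (e i ^ k - e ((i + m) mod N) ^ k) + (e i ^ k - e ((i + (N - m)) mod N) ^ k))"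
        unfolding G_def using S i by (rule sum_incident_circulant)
      also have "\<dots> = (\<Sum>m\<in>S. e i ^ k * of_real (2 - 2 * cos (2 * pi * real k * real m / real N)))"
      proof (intro sum.cong refl)
        fix m assume m: "m \<in> S"
        have "(e i ^ k - e ((i + m) mod N) ^ k) + (e i ^ k - e ((i + (N - m)) mod N) ^ k) =
            e i ^ k * (2 - (e m ^ k + inverse (e m) ^ k))"
          unfolding e_mod e_add e_minus[OF m] power_mult_distrib by (simp add: algebra_simps)
        also have "\<dots> = e i ^ k * of_real (2 - 2 * cos (2 * pi * real k * real m / real N))"
          unfolding e_cos by simp
        finally show "(e i ^ k - e ((i + m) mod N) ^ k) + (e i ^ k - e ((i + (N - m)) mod N) ^ k) = \<dots>" .
      qed
      also have "\<dots> = e i ^ k * of_real (lam k)"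
        by (simp only: lam_def of_real_sum sum_distrib_left)
      finally show ?thesis .
    qed
    moreover have "(\<Sum>j<N. of_bool (j = 0) * e j ^ k) = 1" for k
    proof -
      have "(\<Sum>j<N. of_bool (j = 0) * e j ^ k) = (\<Sum>j<N. if j = 0 then e j ^ k else 0)"
        by (intro sum.cong) auto
      then show ?thesis
        using N e0 by (simp add: sum.delta)
    qed
    ultimately show ?thesis
      unfolding L_def reduced_laplacian_def F_def A1_def mat_mult_mat by (intro eq_matI) auto
  qed
  then have det1: "det A1 = of_nat (\<tau> G) * det F"
    using matrix_tree[of G N, where 'a = complex] finite_multigraph_circulant[OF N S(1)] N
      det_mult[of L N F]
    by (simp add: L_def F_def G_def circulant_graph_def reduced_laplacian_def)
  have "F * D = A2"
  proof -
    have "(\<Sum>j<N. e i ^ j * ((if j = k then of_real (lam k) else 0) + (if j = 0 then 1 else 0))) =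
      e i ^ k * of_real (lam k) + 1" if "k < N" for i k
    proof -
      have "(\<Sum>j<N. e i ^ j * ((if j = k then of_real (lam k) else 0) + (if j = 0 then 1 else 0))) =
        (\<Sum>j<N. if j = k then e i ^ j * of_real (lam k) else 0) + (\<Sum>j<N. if j = 0 then e i ^ j else 0)"
        unfolding sum.distrib[symmetric] by (intro sum.cong) auto
      then show ?thesis
        using that N by (simp add: sum.delta)
    qed
    then show ?thesis
      unfolding F_def D_def A2_def mat_mult_mat by (intro eq_matI) auto
  qed
  moreover have "det D = (\<Prod>k\<in>{0<..<N}. of_real (lam k))"
  proof -
    have "det D = prod_list (diag_mat D)"
      by (rule det_upper_triangular[of _ N]) (auto simp: D_def upper_triangular_def)
    also have "\<dots> = (\<Prod>k = 0..<N. D $$ (k, k))"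
      by (simp add: prod_list_diag_prod D_def)
    also have "{0..<N} = insert 0 {0<..<N}"
      using N by auto
    finally show ?thesis
      using N lam0 by (simp add: D_def)
  qed
  ultimately have det2: "det A2 = det F * (\<Prod>k\<in>{0<..<N}. of_real (lam k))"
    using det_mult[of F N D] by (simp add: F_def D_def)
  have "X * A1 = U * A2"
  proof -
    \<comment> \<open>A non-trivial character sums to 0, and for \<open>k = 0\<close> the eigenvalue
      is 0, so only the added ones survive.\<close>
    have row0: "(\<Sum>j<N. (e j ^ k * of_real (lam k) + 1)) = of_nat N" if "k < N" for k
    proof -
      have "(\<Sum>j<N. (e j ^ k * of_real (lam k) + 1)) = (\<Sum>j<N. e j ^ k) * of_real (lam k) + of_nat N"
        by (simp add: sum.distrib sum_distrib_right)
      then show ?thesis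
        using sum_e[OF that] lam0 by simp
    qed
    have U: "(\<Sum>j<N. (if i = 0 \<or> i = j then 1 else 0) * (e j ^ k * of_real (lam k) + 1)) =
      (if i = 0 then of_nat N else e i ^ k * of_real (lam k) + 1)" if "i < N" "k < N" for i k
    proof (cases "i = 0")
      case False
      then have "(\<Sum>j<N. (if i = 0 \<or> i = j then 1 else 0) * (e j ^ k * of_real (lam k) + 1)) =
        (\<Sum>j<N. if i = j then e j ^ k * of_real (lam k) + 1 else 0)"
        by (intro sum.cong) auto
      then show ?thesis
        using that False by (simp add: sum.delta')
    qed (use row0 that in simp)
    have X: "(\<Sum>j<N. (if j = 0 then (if i = 0 then of_nat N else 1) else if i = j then 1 else 0) *
        (if j = 0 then 1 else e j ^ k * of_real (lam k))) =
      (if i = 0 then of_nat N else e i ^ k * of_real (lam k) + 1)" if "i < N" "k < N" for i k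
    proof -
      have "(\<Sum>j<N. (if j = 0 then (if i = 0 then of_nat N else 1) else if i = j then 1 else 0) *
          (if j = 0 then 1 else e j ^ k * of_real (lam k))) =
        (\<Sum>j<N. if j = 0 then (if i = 0 then of_nat N else 1) else 0) +
        (\<Sum>j<N. if i = j then (if i = 0 then 0 else e i ^ k * of_real (lam k)) else 0)"
        unfolding sum.distrib[symmetric] by (intro sum.cong) auto
      then show ?thesis
        using that N by (simp add: sum.delta sum.delta')
    qed
    show ?thesis
      unfolding X_def U_def A1_def A2_def mat_mult_mat by (intro eq_matI) (simp_all add: X U)
  qed
  moreover have "det X = of_nat N"
  proof -
    have "det X = prod_list (diag_mat X)"
      by (rule det_lower_triangular[of N]) (auto simp: X_def)
    also have "\<dots> = (\<Prod>k = 0..<N. X $$ (k, k))"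
      by (simp add: prod_list_diag_prod X_def)
    also have "{0..<N} = insert 0 {0<..<N}"
      using N by auto
    finally show ?thesis
      using N by (simp add: X_def)
  qed
  moreover have "det U = 1"
  proof -
    have "det U = prod_list (diag_mat U)"
      by (rule det_upper_triangular[of _ N]) (auto simp: U_def upper_triangular_def)
    also have "\<dots> = (\<Prod>k = 0..<N. U $$ (k, k))"
      by (simp add: prod_list_diag_prod U_def)
    finally show ?thesis
      by (simp add: U_def)
  qed
  ultimately have "of_nat N * det A1 = det A2"
    using det_mult[of X N A1] det_mult[of U N A2] by (simp add: X_def U_def A1_def A2_def)
  then have "of_nat N * of_nat (\<tau> G) = (\<Prod>k\<in>{0<..<N}. complex_of_real (lam k))"
    unfolding det1 det2 using F by simp
  then have "complex_of_real (real N * real (\<tau> G)) = complex_of_real (\<Prod>k\<in>{0<..<N}. lam k)"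
    by simp
  then show ?thesis
    unfolding of_real_eq_iff G_def lam_def .
qed

subsection \<open>Trigonometric products\<close>

text \<open>Both sides have degree at most \<open>n\<close> and leading coefficient 1, and they
  agree at the \<open>n\<close> distinct roots of unity.\<close>

lemma prod_linear_roots_of_unity:
  fixes n :: nat
  assumes "n > 0"
  shows "(\<Prod>l<n. [:- cis (2 * pi * real l / real n), 1:]) = monom 1 n - 1" (is "?P = ?Q")
proof -
  let ?e = "\<lambda>l. cis (2 * pi * real l / real n)"
  have deg: "degree ?P = n"
    by (subst degree_prod_sum_eq) auto
  have "lead_coeff ?P = 1"
    by (simp add: lead_coeff_prod)
  then have "coeff ?P n = coeff ?Q n"
    using assms deg by (simp add: coeff_eq_0)
  moreover have "degree ?Q \<le> n"
    by (intro degree_diff_le) (auto simp: degree_monom_le)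
  moreover have "card (?e ` {..<n}) = n"
    using bij_betw_imp_inj_on[OF bij_betw_roots_unity[OF assms]] by (simp add: card_image)
  moreover have "poly ?P z = poly ?Q z" if z: "z \<in> ?e ` {..<n}" for z
  proof -
    obtain l where l: "l < n" "z = ?e l"
      using z by auto
    have "z ^ n = 1"
      using bij_betwE[OF bij_betw_roots_unity[OF assms]] l by auto
    moreover have "poly ?P z = 0"
      unfolding poly_prod using l by (intro prod_zero) auto
    ultimately show ?thesis
      by (simp add: poly_monom)
  qed
  ultimately show ?thesis
    using deg by (intro poly_eqI_degree_lead_coeff[where n = n and A = "?e ` {..<n}"]) auto
qed

lemma prod_diff_roots_of_unity:
  fixes n :: nat and z :: complex
  assumes "n > 0"
  shows "(\<Prod>l<n. z - cis (2 * pi * real l / real n)) = z ^ n - 1"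
  using arg_cong[OF prod_linear_roots_of_unity[OF assms], of "\<lambda>p. poly p z"]
  by (simp add: poly_prod poly_monom)

text \<open>The factor for the root 1 is cancelled between polynomials, so that the identity also
  holds at \<open>z = 1\<close>.\<close>

lemma prod_diff_nontrivial_roots_of_unity:
  fixes n :: nat and z :: complex
  assumes "n > 0"
  shows "(\<Prod>l\<in>{1..<n}. z - cis (2 * pi * real l / real n)) = (\<Sum>i<n. z ^ i)"
proof -
  have split: "{..<n} = insert 0 {1..<n}"
    using assms by auto
  have "[:-1, 1:] * (\<Prod>l\<in>{1..<n}. [:- cis (2 * pi * real l / real n), 1:]) = [:0, 1:] ^ n - 1"
    using prod_linear_roots_of_unity[OF assms] unfolding split by (simp add: monom_altdef)
  also have "\<dots> = ([:0, 1:] - 1) * (\<Sum>i<n. [:0, 1:] ^ i)"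
    by (rule power_diff_1_eq)
  also have "[:0, 1:] - 1 = [:-1, 1 :: complex:]"
    by (simp add: one_pCons)
  finally have "(\<Prod>l\<in>{1..<n}. [:- cis (2 * pi * real l / real n), 1:]) = (\<Sum>i<n. [:0, 1:] ^ i)"
    by (subst (asm) mult_cancel_left) auto
  from arg_cong[OF this, of "\<lambda>p. poly p z"] show ?thesis
    by (simp add: poly_prod poly_sum)
qed

lemma norm_cis_diff: "cmod (cis a - cis b) = 2 * \<bar>sin ((a - b) / 2)\<bar>"
proof -
  have "(cmod (cis a - cis b))\<^sup>2 = (cos a - cos b)\<^sup>2 + (sin a - sin b)\<^sup>2"
    by (simp add: cmod_power2)
  also have "\<dots> = (cos a)\<^sup>2 + (sin a)\<^sup>2 + ((cos b)\<^sup>2 + (sin b)\<^sup>2) - 2 * (cos a * cos b + sin a * sin b)"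
    by (simp add: power2_eq_square algebra_simps)
  also have "\<dots> = 2 - 2 * cos (a - b)"
    by (simp add: cos_diff)
  also have "cos (a - b) = 1 - 2 * (sin ((a - b) / 2))\<^sup>2"
    using cos_double_sin[of "(a - b) / 2"] by (simp only: nonzero_mult_div_cancel_left times_divide_eq_right)
  finally have "(cmod (cis a - cis b))\<^sup>2 = (2 * \<bar>sin ((a - b) / 2)\<bar>)\<^sup>2"
    by (simp add: power_mult_distrib)
  then show ?thesis
    by (rule power2_eq_imp_eq) simp_all
qed

text \<open>Twice each factor is the length of the chord from \<open>cis (- 2 * x)\<close> to an
  \<open>n\<close>-th root of unity.\<close>

lemma prod_abs_sin_shifts:
  fixes n :: nat
  assumes "n > 0"
  shows "(\<Prod>l<n. \<bar>sin (x + pi * real l / real n)\<bar>) = 2 / 2 ^ n * \<bar>sin (real n * x)\<bar>"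
proof -
  have "2 ^ n * (\<Prod>l<n. \<bar>sin (x + pi * real l / real n)\<bar>) = (\<Prod>l<n. 2 * \<bar>sin (x + pi * real l / real n)\<bar>)"
    by (simp add: prod.distrib)
  also have "\<dots> = (\<Prod>l<n. cmod (cis (- 2 * x) - cis (2 * pi * real l / real n)))"
  proof (intro prod.cong refl)
    fix l
    have "(- 2 * x - 2 * pi * real l / real n) / 2 = - (x + pi * real l / real n)"
      by simp
    then show "2 * \<bar>sin (x + pi * real l / real n)\<bar> = cmod (cis (- 2 * x) - cis (2 * pi * real l / real n))"
      unfolding norm_cis_diff by (simp only: sin_minus abs_minus_cancel)
  qed
  also have "\<dots> = cmod (cis (- 2 * x) ^ n - 1)"
    by (simp add: prod_norm prod_diff_roots_of_unity[OF assms])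
  also have "\<dots> = cmod (cis (real n * (- 2 * x)) - cis 0)"
    by (simp only: Complex.DeMoivre cis_zero)
  also have "\<dots> = 2 * \<bar>sin (real n * x)\<bar>"
    unfolding norm_cis_diff by simp
  finally show ?thesis
    by (simp add: field_simps)
qed

text \<open>The chords from 1 to the other \<open>n\<close>-th roots of unity have product
  \<open>n\<close>.\<close>

lemma prod_sin_multiples:
  fixes n :: nat
  assumes "n > 0"
  shows "(\<Prod>l\<in>{1..<n}. sin (pi * real l / real n)) = real n / 2 ^ (n - 1)"
proof -
  have "2 ^ (n - 1) * (\<Prod>l\<in>{1..<n}. sin (pi * real l / real n)) = (\<Prod>l\<in>{1..<n}. 2 * sin (pi * real l / real n))"
    by (simp add: prod.distrib)
  also have "\<dots> = (\<Prod>l\<in>{1..<n}. cmod (1 - cis (2 * pi * real l / real n)))"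
  proof (intro prod.cong refl)
    fix l assume "l \<in> {1..<n}"
    then have "0 \<le> sin (pi * real l / real n)"
      by (intro sin_ge_zero) (auto simp: field_simps)
    then show "2 * sin (pi * real l / real n) = cmod (1 - cis (2 * pi * real l / real n))"
      using norm_cis_diff[of 0 "2 * pi * real l / real n"] by simp
  qed
  also have "\<dots> = real n"
    unfolding prod_norm prod_diff_nontrivial_roots_of_unity[OF assms] by simp
  finally show ?thesis
    by (simp add: field_simps)
qed

text \<open>Telescoping: \<open>2 * sin t * cos (2 * t * m)\<close> is the difference of the sines
  of \<open>(2 * m + 1) * t\<close> and \<open>(2 * m - 1) * t\<close>.\<close>

lemma sin_times_sum_cos:
  "sin t * (\<Sum>m\<in>{1..r}. 2 - 2 * cos (2 * t * real m)) = (2 * real r + 1) * sin t - sin ((2 * real r + 1) * t)"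
proof (induction r)
  case (Suc r)
  define u where "u = 2 * t * real (Suc r)"
  have "(2 * real (Suc r) + 1) * t = u + t" "(2 * real r + 1) * t = u - t"
    by (simp_all add: u_def algebra_simps)
  then have "sin ((2 * real (Suc r) + 1) * t) - sin ((2 * real r + 1) * t) = 2 * sin t * cos (2 * t * real (Suc r))"
    unfolding u_def[symmetric] by (simp add: sin_add sin_diff)
  then show ?case
    using Suc by (simp add: algebra_simps)
qed simp

text \<open>The factors at \<open>j\<close> and \<open>b - j\<close> are paired; a midpoint exists
  only for even \<open>b\<close>.\<close>

lemma prod_symmetric:
  fixes f :: "nat \<Rightarrow> 'a :: comm_semiring_1"
  assumes sym: "\<And>j. j \<in> {1..<b} \<Longrightarrow> f (b - j) = f j"
    and mid: "\<And>j. 2 * j = b \<Longrightarrow> f j = 1"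
  shows "(\<Prod>j\<in>{1..<b}. f j) = (\<Prod>j = 1..(b - 1) div 2. (f j)\<^sup>2)"
proof -
  define A where "A = {1..(b - 1) div 2}"
  define M where "M = {j \<in> {1..<b}. 2 * j = b}"
  have B: "{1..<b} = A \<union> M \<union> (\<lambda>j. b - j) ` A"
  proof (intro equalityI subsetI)
    fix j assume j: "j \<in> {1..<b}"
    show "j \<in> A \<union> M \<union> (\<lambda>j. b - j) ` A"
    proof (cases "2 * j > b")
      case True
      then have "b - j \<in> A" "j = b - (b - j)"
        using j by (auto simp: A_def)
      then show ?thesis by blast
    qed (use j in \<open>auto simp: A_def M_def\<close>)
  qed (auto simp: A_def M_def)
  have "(\<Prod>j\<in>{1..<b}. f j) = (\<Prod>j\<in>A \<union> M. f j) * (\<Prod>j\<in>(\<lambda>j. b - j) ` A. f j)"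
    unfolding B by (rule prod.union_disjoint) (auto simp: A_def M_def)
  also have "(\<Prod>j\<in>A \<union> M. f j) = (\<Prod>j\<in>A. f j) * (\<Prod>j\<in>M. f j)"
    by (rule prod.union_disjoint) (auto simp: A_def M_def)
  also have "(\<Prod>j\<in>M. f j) = 1"
    using mid by (intro prod.neutral) (auto simp: M_def)
  also have "(\<Prod>j\<in>(\<lambda>j. b - j) ` A. f j) = (\<Prod>j\<in>A. f (b - j))"
    by (subst prod.reindex) (auto simp: inj_on_def A_def)
  also have "\<dots> = (\<Prod>j\<in>A. f j)"
    using sym by (intro prod.cong refl) (auto simp: A_def)
  finally show ?thesis
    by (simp add: A_def power2_eq_square prod.distrib)
qed

lemma prod_residue_classes:
  fixes f :: "nat \<Rightarrow> 'a :: comm_monoid_mult"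
  shows "(\<Prod>k<n * b. f k) = (\<Prod>j<b. \<Prod>l<n. f (j + b * l))"
proof -
  have "(\<Prod>k<n * b. f k) = (\<Prod>l<n. \<Prod>k\<in>{l * b..<l * b + b}. f k)"
    by (rule prod.nat_group[symmetric])
  also have "\<dots> = (\<Prod>l<n. \<Prod>j<b. f (j + b * l))"
  proof (rule prod.cong[OF refl])
    fix l
    show "(\<Prod>k\<in>{l * b..<l * b + b}. f k) = (\<Prod>j<b. f (j + b * l))"
      using prod.shift_bounds_nat_ivl[of f 0 "l * b" b] by (simp add: atLeast0LessThan add.commute mult.commute)
  qed
  also have "\<dots> = (\<Prod>j<b. \<Prod>l<n. f (j + b * l))"
    by (rule prod.swap)
  finally show ?thesis .
qed

subsection \<open>Power graphs of cycles\<close>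

text \<open>\<open>R j\<close> and \<open>\<psi> j\<close> are amplitude and phase of the sine wave
  on the residue class of \<open>j\<close>. They are left abstract, so that the phase can be chosen
  separately on the two halves of the range of \<open>j\<close>.\<close>

lemma \<tau>_power_graph_product:
  fixes \<beta> n r :: nat and \<sigma> :: real and R \<psi> :: "nat \<Rightarrow> real"
  assumes \<beta>: "\<beta> \<ge> 2" and n: "n \<ge> 1" and \<sigma>: "\<sigma> = 1 \<or> \<sigma> = -1"
    and r: "2 * real r + 1 = 2 * real n + \<sigma>"
    and R: "\<And>j. j \<in> {1..<\<beta>} \<Longrightarrow> R j \<ge> 0"
    and cos\<psi>: "\<And>j. j \<in> {1..<\<beta>} \<Longrightarrow> R j * cos (\<psi> j) = 2 * real n * cos (pi * real j / real \<beta>)"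
    and sin\<psi>: "\<And>j. j \<in> {1..<\<beta>} \<Longrightarrow> R j * sin (\<psi> j) = (2 * real n + 2 * \<sigma>) * sin (pi * real j / real \<beta>)"
  shows "real (\<beta> * n) * real (\<tau> (power_graph r (\<beta> * n))) = (2 * real n) ^ (n - 1) *
    (\<Prod>j\<in>{1..<\<beta>}. R j ^ n * \<bar>sin (pi * real j / real \<beta> + \<sigma> * real n * (pi * real j / real \<beta> - \<psi> j))\<bar>
      / sin (pi * real j / real \<beta>))"
proof -
  define N where "N = \<beta> * n"
  define \<theta> where "\<theta> k = pi * real k / real N" for k :: nat
  define x where "x j = pi * real j / real \<beta>" for j :: nat
  define lam where "lam k = (\<Sum>m\<in>{1..r}. 2 - 2 * cos (2 * pi * real k * real m / real N))" for k :: nat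
  have N: "N > 0"
    using \<beta> n by (simp add: N_def)
  have "real r \<le> real n"
    using r \<sigma> by auto
  then have "r \<le> n"
    by simp
  also have "n < N"
    using \<beta> n by (simp add: N_def)
  finally have "{1..r} \<subseteq> {0<..<N}"
    by auto
  then have \<tau>: "real N * real (\<tau> (power_graph r N)) = (\<Prod>k\<in>{0<..<N}. lam k)"
    unfolding power_graph_def lam_def using N by (intro \<tau>_circulant) auto
  have lam_nonneg: "lam k \<ge> 0" for k
    unfolding lam_def by (intro sum_nonneg) simp
  have \<theta>: "\<theta> (j + \<beta> * l) = x j / real n + pi * real l / real n" for j l
    using \<beta> n by (simp add: \<theta>_def x_def N_def field_simps)
  have lam: "lam k * sin (\<theta> k) = (2 * real n + \<sigma>) * sin (\<theta> k) - \<sigma> * sin (\<theta> k + 2 * \<sigma> * x j)"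
    if k: "k = j + \<beta> * l" for k j l
  proof -
    \<comment> \<open>Because \<open>2 * n * \<theta> k = 2 * pi * k / \<beta>\<close>, and
      \<open>k = j + \<beta> * l\<close>.\<close>
    have "(2 * real n + \<sigma>) * \<theta> k = 2 * x j + \<sigma> * \<theta> k + 2 * real l * pi"
      unfolding k \<theta> using n by (simp add: field_simps)
    then have "sin ((2 * real n + \<sigma>) * \<theta> k) = sin (2 * x j + \<sigma> * \<theta> k)"
      by (simp only: sin_add[of _ "2 * real l * pi"] sin_2npi cos_2npi mult_1_right mult_zero_right add_0_right)
    also have "\<dots> = \<sigma> * sin (\<theta> k + 2 * \<sigma> * x j)"
      using \<sigma> sin_minus[of "\<theta> k - 2 * x j"] by (auto simp: add.commute)
    finally show ?thesis
      using sin_times_sum_cos[of "\<theta> k" r] r by (simp add: lam_def \<theta>_def mult_ac)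
  qed
  have main: "(\<Prod>l<n. lam (j + \<beta> * l)) = R j ^ n * \<bar>sin (x j + \<sigma> * real n * (x j - \<psi> j))\<bar> / sin (x j)"
    if j: "j \<in> {1..<\<beta>}" for j
  proof -
    have "x j < pi"
      using j \<beta> by (simp add: x_def field_simps)
    then have sinx: "sin (x j) > 0"
      using j by (intro sin_gt_zero) (auto simp: x_def)
    have step: "lam (j + \<beta> * l) * \<bar>sin (x j / real n + pi * real l / real n)\<bar> =
        R j * \<bar>sin ((x j / real n + \<sigma> * (x j - \<psi> j)) + pi * real l / real n)\<bar>" for l
    proof -
      define t where "t = \<theta> (j + \<beta> * l)"
      \<comment> \<open>Centring at \<open>u\<close> makes the two sines those of
        \<open>u - \<sigma> * x j\<close> and \<open>u + \<sigma> * x j\<close>; expanding them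
        yields exactly the coefficients in the hypotheses on \<open>\<psi>\<close>.\<close>
      define u where "u = t + \<sigma> * x j"
      have "lam (j + \<beta> * l) * sin t = (2 * real n + \<sigma>) * sin (u - \<sigma> * x j) - \<sigma> * sin (u + \<sigma> * x j)"
        using lam[OF refl, of j l] by (simp add: t_def u_def add.commute mult.assoc)
      also have "\<dots> = sin u * (2 * real n * cos (x j)) - \<sigma> * cos u * ((2 * real n + 2 * \<sigma>) * sin (x j))"
        using \<sigma> by (auto simp: sin_add sin_diff algebra_simps)
      also have "\<dots> = R j * sin (u - \<sigma> * \<psi> j)"
        unfolding x_def cos\<psi>[OF j, symmetric] sin\<psi>[OF j, symmetric]
        using \<sigma> by (auto simp: sin_add sin_diff algebra_simps)
      finally have "\<bar>lam (j + \<beta> * l) * sin t\<bar> = \<bar>R j * sin (u - \<sigma> * \<psi> j)\<bar>"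
        by simp
      moreover have "u - \<sigma> * \<psi> j = (x j / real n + \<sigma> * (x j - \<psi> j)) + pi * real l / real n"
        by (simp add: u_def t_def \<theta> algebra_simps)
      ultimately show ?thesis
        using lam_nonneg R[OF j] by (simp add: abs_mult t_def \<theta>)
    qed
    have "(\<Prod>l<n. lam (j + \<beta> * l)) * (2 / 2 ^ n * sin (x j)) =
        (\<Prod>l<n. lam (j + \<beta> * l)) * (\<Prod>l<n. \<bar>sin (x j / real n + pi * real l / real n)\<bar>)"
      using prod_abs_sin_shifts[of n "x j / real n"] n sinx by simp
    also have "\<dots> = (\<Prod>l<n. R j * \<bar>sin ((x j / real n + \<sigma> * (x j - \<psi> j)) + pi * real l / real n)\<bar>)"
      unfolding prod.distrib[symmetric] step ..
    also have "\<dots> = R j ^ n * (2 / 2 ^ n * \<bar>sin (real n * (x j / real n + \<sigma> * (x j - \<psi> j)))\<bar>)"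
      using prod_abs_sin_shifts[of n] n by (simp add: prod.distrib)
    also have "real n * (x j / real n + \<sigma> * (x j - \<psi> j)) = x j + \<sigma> * real n * (x j - \<psi> j)"
      using n by (simp add: field_simps)
    finally show ?thesis
      using sinx by (simp add: field_simps)
  qed
  \<comment> \<open>In the class of 0 the angle \<open>x 0\<close> vanishes, so the sine wave is
    \<open>2 * n * sin (\<theta> k)\<close>.\<close>
  have zero: "lam (\<beta> * l) = 2 * real n" if l: "l \<in> {0<..<n}" for l
  proof -
    have "pi * real l / real n < pi"
      using l by (simp add: field_simps)
    then have "sin (pi * real l / real n) > 0"
      using l by (intro sin_gt_zero) auto
    then show ?thesis
      using lam[of "\<beta> * l" 0 l] \<theta>[of 0 l] by (simp add: x_def algebra_simps)
  qed
  \<comment> \<open>The eigenvalue 0 is replaced by 1, so that the product can run over complete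
    residue classes.\<close>
  define f where "f k = (if k = 0 then 1 else lam k)" for k
  have "(\<Prod>k\<in>{0<..<N}. lam k) = (\<Prod>k<N. f k)"
    by (rule prod.mono_neutral_cong_left) (auto simp: f_def)
  also have "\<dots> = (\<Prod>j<\<beta>. \<Prod>l<n. f (j + \<beta> * l))"
    using prod_residue_classes[of f n \<beta>] by (simp add: N_def mult.commute)
  also have "{..<\<beta>} = insert 0 {1..<\<beta>}"
    using \<beta> by auto
  also have "(\<Prod>j\<in>insert 0 {1..<\<beta>}. \<Prod>l<n. f (j + \<beta> * l)) =
      (\<Prod>l<n. f (\<beta> * l)) * (\<Prod>j\<in>{1..<\<beta>}. \<Prod>l<n. f (j + \<beta> * l))"
    by simp
  also have "(\<Prod>l<n. f (\<beta> * l)) = (\<Prod>l\<in>{0<..<n}. 2 * real n)"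
    using \<beta> zero by (intro prod.mono_neutral_cong_right) (auto simp: f_def)
  also have "\<dots> = (2 * real n) ^ (n - 1)"
    by simp
  also have "(\<Prod>j\<in>{1..<\<beta>}. \<Prod>l<n. f (j + \<beta> * l)) =
      (\<Prod>j\<in>{1..<\<beta>}. R j ^ n * \<bar>sin (x j + \<sigma> * real n * (x j - \<psi> j))\<bar> / sin (x j))"
  proof (rule prod.cong[OF refl])
    fix j assume j: "j \<in> {1..<\<beta>}"
    then have "(\<Prod>l<n. f (j + \<beta> * l)) = (\<Prod>l<n. lam (j + \<beta> * l))"
      by (intro prod.cong) (auto simp: f_def)
    then show "(\<Prod>l<n. f (j + \<beta> * l)) = R j ^ n * \<bar>sin (x j + \<sigma> * real n * (x j - \<psi> j))\<bar> / sin (x j)"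
      using main[OF j] by simp
  qed
  finally show ?thesis
    using \<tau> by (simp add: N_def x_def)
qed

text \<open>\<open>p > 0\<close> puts the point \<open>(p, q)\<close> in the right half plane, where
  \<open>arcsin\<close> recovers the polar angle.\<close>

lemma polar_arcsin:
  fixes p q :: real
  assumes "p > 0"
  defines "R \<equiv> sqrt (p\<^sup>2 + q\<^sup>2)"
  shows "R * cos (arcsin (q / R)) = p" "R * sin (arcsin (q / R)) = q"
proof -
  have R: "R > 0" "R\<^sup>2 = p\<^sup>2 + q\<^sup>2"
    using assms by (auto simp: R_def add_pos_nonneg)
  have "\<bar>q\<bar> \<le> R"
    unfolding R_def by (rule real_le_rsqrt) simp
  then have q: "- 1 \<le> q / R" "q / R \<le> 1"
    using R by (auto simp: field_simps)
  then show "R * sin (arcsin (q / R)) = q"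
    using R by simp
  have "1 - (q / R)\<^sup>2 = (R\<^sup>2 - q\<^sup>2) / R\<^sup>2"
    using R(1) by (simp add: power_divide diff_divide_distrib)
  also have "\<dots> = (p / R)\<^sup>2"
    unfolding power_divide using R(2) by simp
  finally have "1 - (q / R)\<^sup>2 = (p / R)\<^sup>2" .
  then show "R * cos (arcsin (q / R)) = p"
    using q R assms(1) by (simp add: cos_arcsin)
qed

theorem \<tau>_power_graph_closed_form:
  fixes \<beta> n r :: nat and \<sigma> :: real
  assumes \<beta>: "\<beta> \<ge> 2" and n: "n \<ge> 1" and \<sigma>: "\<sigma> = 1 \<or> \<sigma> = -1"
    and r: "2 * real r + 1 = 2 * real n + \<sigma>"
  shows "real (\<beta> * n) * real (\<tau> (power_graph r (\<beta> * n))) =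
    (2 * real n) ^ (n - 1) * (\<bar>(1 + 2 * \<sigma> * real n) ^ \<beta> - 1\<bar> / (2 * real n)) ^ n * (2 ^ (\<beta> - 1) / real \<beta>) *
    (\<Prod>k = 1..(\<beta> - 1) div 2. (sin (pi * real k / real \<beta> + \<sigma> * real n * (pi * real k / real \<beta>
      - arcsin ((real n + \<sigma>) / sqrt (4 * (real n)\<^sup>2 / cycle_eigenvalue \<beta> k + \<sigma> * (2 * real n + \<sigma>))))))\<^sup>2)"
proof -
  define x where "x j = pi * real j / real \<beta>" for j :: nat
  define R where "R j = sqrt ((2 * real n * cos (x j))\<^sup>2 + ((2 * real n + 2 * \<sigma>) * sin (x j))\<^sup>2)" for j
  have R2: "(R j)\<^sup>2 = (2 * real n * cos (x j))\<^sup>2 + ((2 * real n + 2 * \<sigma>) * sin (x j))\<^sup>2" for j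
    unfolding R_def by (rule real_sqrt_pow2) simp
  have R2': "(R j)\<^sup>2 = 4 * (real n)\<^sup>2 + 4 * \<sigma> * (2 * real n + \<sigma>) * (sin (x j))\<^sup>2" for j
  proof -
    have "(R j)\<^sup>2 = 4 * (real n)\<^sup>2 * (cos (x j))\<^sup>2 + (4 * (real n)\<^sup>2 + 8 * \<sigma> * real n + 4 * (\<sigma> * \<sigma>)) * (sin (x j))\<^sup>2"
      unfolding R2 by (simp add: power2_eq_square algebra_simps)
    also have "(cos (x j))\<^sup>2 = 1 - (sin (x j))\<^sup>2"
      by (rule cos_squared_eq)
    finally show ?thesis
      by (simp add: power2_eq_square algebra_simps)
  qed
  define A where "A k = arcsin ((real n + \<sigma>) / sqrt (4 * (real n)\<^sup>2 / cycle_eigenvalue \<beta> k + \<sigma> * (2 * real n + \<sigma>)))" for k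
  \<comment> \<open>\<open>arcsin\<close> gives the phase only where \<open>cos (x j) > 0\<close>,
    that is, \<open>2 * j < \<beta>\<close>. The upper half follows by reflection, and in the middle
    the vector is vertical.\<close>
  define \<psi> where "\<psi> j = (if 2 * j < \<beta> then A j else if 2 * j = \<beta> then pi / 2 else pi - A (\<beta> - j))" for j
  \<comment> \<open>At the middle index this identifies the amplitude with
    \<open>2 * n + 2 * \<sigma>\<close>; it is 0 for \<open>n = 1\<close>,
    \<open>\<sigma> = -1\<close>.\<close>
  have n\<sigma>: "real n + \<sigma> \<ge> 0"
    using \<sigma> n by auto
  have x_reflect: "x (\<beta> - j) = pi - x j" if "j < \<beta>" for j
    using that by (simp add: x_def of_nat_diff field_simps)
  have x_mid: "x j = pi / 2" if "2 * j = \<beta>" for j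
    using that \<beta> by (auto simp: x_def field_simps)
  have sin_x: "sin (x j) > 0" if "j \<in> {1..<\<beta>}" for j
    using that \<beta> by (intro sin_gt_zero) (auto simp: x_def field_simps)
  have A: "R j * cos (A j) = 2 * real n * cos (x j)" "R j * sin (A j) = (2 * real n + 2 * \<sigma>) * sin (x j)"
    if j: "j \<in> {1..<\<beta>}" "2 * j < \<beta>" for j
  proof -
    have "real j * 2 < real \<beta>"
      using j by linarith
    then have "x j < pi / 2"
      using \<beta> by (simp add: x_def field_simps)
    moreover have "x j > 0"
      using j \<beta> by (simp add: x_def)
    ultimately have "cos (x j) > 0"
      by (intro cos_gt_zero_pi) auto
    then have p: "2 * real n * cos (x j) > 0"
      using n by simp
    have "cycle_eigenvalue \<beta> j = 4 * (sin (x j))\<^sup>2"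
      using cos_double_sin[of "x j"] by (simp add: cycle_eigenvalue_def x_def mult.assoc)
    moreover note R2'[of j]
    ultimately have "4 * (real n)\<^sup>2 / cycle_eigenvalue \<beta> j + \<sigma> * (2 * real n + \<sigma>) = (R j / (2 * sin (x j)))\<^sup>2"
      using sin_x[OF j(1)] by (simp add: power_divide power_mult_distrib field_simps)
    then have "sqrt (4 * (real n)\<^sup>2 / cycle_eigenvalue \<beta> j + \<sigma> * (2 * real n + \<sigma>)) = R j / (2 * sin (x j))"
      using sin_x[OF j(1)] by (simp add: R_def)
    then have "A j = arcsin ((2 * real n + 2 * \<sigma>) * sin (x j) / R j)"
      by (simp add: A_def algebra_simps)
    then show "R j * cos (A j) = 2 * real n * cos (x j)" "R j * sin (A j) = (2 * real n + 2 * \<sigma>) * sin (x j)"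
      using polar_arcsin[OF p] by (simp_all add: R_def)
  qed
  have R_reflect: "R (\<beta> - j) = R j" if "j < \<beta>" for j
    using x_reflect[OF that] by (simp add: R_def)
  have \<psi>: "R j * cos (\<psi> j) = 2 * real n * cos (x j) \<and> R j * sin (\<psi> j) = (2 * real n + 2 * \<sigma>) * sin (x j)"
    if j: "j \<in> {1..<\<beta>}" for j
  proof -
    consider "2 * j < \<beta>" | "2 * j = \<beta>" | "2 * j > \<beta>"
      by linarith
    then show ?thesis
    proof cases
      case 1
      then show ?thesis
        using A[OF j 1] by (simp add: \<psi>_def)
    next
      case 2
      then have "cos (x j) = 0" "sin (x j) = 1"
        by (simp_all only: x_mid cos_pi_half sin_pi_half)
      then show ?thesis
        using 2 n\<sigma> by (simp add: \<psi>_def R_def)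
    next
      case 3
      then have "\<beta> - j \<in> {1..<\<beta>}" "2 * (\<beta> - j) < \<beta>"
        using j by auto
      from A[OF this] show ?thesis
        using 3 j x_reflect[of j] R_reflect[of j] by (simp add: \<psi>_def)
    qed
  qed
  define T where "T j = \<bar>sin (x j + \<sigma> * real n * (x j - \<psi> j))\<bar>" for j
  have "(\<Prod>j\<in>{1..<\<beta>}. T j) = (\<Prod>k = 1..(\<beta> - 1) div 2. (T k)\<^sup>2)"
  proof (rule prod_symmetric)
    fix j assume j: "j \<in> {1..<\<beta>}"
    have \<psi>_reflect: "\<psi> (\<beta> - j) = pi - \<psi> j"
      using j by (auto simp: \<psi>_def)
    have j': "j < \<beta>"
      using j by simp
    have "x (\<beta> - j) + \<sigma> * real n * (x (\<beta> - j) - \<psi> (\<beta> - j)) = pi - (x j + \<sigma> * real n * (x j - \<psi> j))"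
      unfolding x_reflect[OF j'] \<psi>_reflect by (simp add: algebra_simps)
    then show "T (\<beta> - j) = T j"
      unfolding T_def by (simp only: sin_pi_minus)
  next
    fix j assume "2 * j = \<beta>"
    then show "T j = 1"
      unfolding T_def x_mid[OF \<open>2 * j = \<beta>\<close>] by (simp add: \<psi>_def)
  qed
  also have "\<dots> = (\<Prod>k = 1..(\<beta> - 1) div 2. (sin (x k + \<sigma> * real n * (x k - A k)))\<^sup>2)"
    by (intro prod.cong refl) (auto simp: T_def \<psi>_def)
  finally have T: "(\<Prod>j\<in>{1..<\<beta>}. T j) = \<dots>" .
  \<comment> \<open>The choice gives \<open>(y - 1)\<^sup>2 = 4 * n\<^sup>2\<close> and
    \<open>y = \<sigma> * (2 * n + \<sigma>)\<close>, the coefficients in \<open>R2'\<close>, so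
    \<open>R j\<close> is the distance of \<open>y\<close> from a root of unity.\<close>
  define y where "y = 1 + 2 * \<sigma> * real n"
  have "R j = cmod (of_real y - cis (2 * pi * real j / real \<beta>))" for j
  proof -
    have "(cmod (of_real y - cis (2 * x j)))\<^sup>2 = (y - cos (2 * x j))\<^sup>2 + (sin (2 * x j))\<^sup>2"
      by (simp add: cmod_power2)
    also have "\<dots> = y\<^sup>2 - 2 * y * cos (2 * x j) + ((sin (2 * x j))\<^sup>2 + (cos (2 * x j))\<^sup>2)"
      by (simp add: power2_eq_square algebra_simps)
    also have "\<dots> = y\<^sup>2 - 2 * y * cos (2 * x j) + 1"
      by (simp only: sin_cos_squared_add)
    also have "\<dots> = (y - 1)\<^sup>2 + 4 * y * (sin (x j))\<^sup>2"
      unfolding cos_double_sin by (simp add: power2_eq_square algebra_simps)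
    also have "\<dots> = (R j)\<^sup>2"
      unfolding R2' using \<sigma> by (auto simp: y_def power2_eq_square algebra_simps)
    finally have "cmod (of_real y - cis (2 * x j)) = R j"
      by (rule power2_eq_imp_eq) (simp_all add: R_def)
    then show ?thesis
      by (simp add: x_def mult.assoc)
  qed
  then have "(\<Prod>j\<in>{1..<\<beta>}. R j) = cmod (\<Sum>i<\<beta>. of_real y ^ i)"
    using \<beta> by (simp only: prod_norm) (subst prod_diff_nontrivial_roots_of_unity, auto)
  also have "\<dots> = \<bar>\<Sum>i<\<beta>. y ^ i\<bar>"
    by (simp only: of_real_power[symmetric] of_real_sum[symmetric] norm_of_real)
  \<comment> \<open>Geometric sum with \<open>\<bar>y - 1\<bar> = 2 * n\<close>.\<close>
  also have "\<dots> = \<bar>y ^ \<beta> - 1\<bar> / (2 * real n)"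
    using \<sigma> n geometric_sum[of y \<beta>] by (auto simp: y_def abs_mult abs_minus_commute)
  finally have prodR: "(\<Prod>j\<in>{1..<\<beta>}. R j) = \<bar>y ^ \<beta> - 1\<bar> / (2 * real n)" .
  have "(\<Prod>j\<in>{1..<\<beta>}. R j ^ n * T j / sin (x j)) =
      (\<bar>y ^ \<beta> - 1\<bar> / (2 * real n)) ^ n * (\<Prod>j\<in>{1..<\<beta>}. T j) / (real \<beta> / 2 ^ (\<beta> - 1))"
    using prod_sin_multiples[of \<beta>] \<beta> by (simp only: prod_dividef prod.distrib prod_power_distrib[symmetric] prodR x_def)
  moreover have "real (\<beta> * n) * real (\<tau> (power_graph r (\<beta> * n))) =
      (2 * real n) ^ (n - 1) * (\<Prod>j\<in>{1..<\<beta>}. R j ^ n * T j / sin (x j))"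
    unfolding T_def x_def using \<psi> by (intro \<tau>_power_graph_product[OF \<beta> n \<sigma> r]) (auto simp: R_def x_def)
  ultimately show ?thesis
    using T by (simp add: y_def x_def A_def)
qed

section \<open>From the closed form to the stated expressions\<close>

lemma ceiling_half: "nat \<lceil>real b / 2\<rceil> - 1 = (b - 1) div 2"
proof -
  define c where "c = (b + 1) div 2"
  have "b \<le> 2 * c" "2 * c \<le> b + 1"
    by (simp_all add: c_def)
  then have "real b \<le> 2 * real c" "2 * real c \<le> real b + 1"
    by linarith+
  then have "\<lceil>real b / 2\<rceil> = int c"
    by (intro ceiling_unique) (simp_all add: field_simps)
  then show ?thesis
    by (simp only: nat_int c_def)
qed

text \<open>With \<open>z = 2 * n + \<sigma>\<close> one has
  \<open>\<sigma> * z = 1 + 2 * \<sigma> * n\<close>, so the absolute value in \<open>t\<close> is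
  \<open>z ^ \<beta>\<close> times the stated one; then
  \<open>z = 2 * n * (1 + \<sigma> / (2 * n))\<close> distributes the power over the stated
  factors.\<close>

lemma closed_form_normalize:
  fixes \<beta> n :: nat and \<sigma> t P :: real
  assumes \<beta>: "\<beta> \<ge> 3" and n: "n \<ge> 1" and \<sigma>: "\<sigma> = 1 \<or> \<sigma> = -1"
    and t: "real (\<beta> * n) * t = (2 * real n) ^ (n - 1) *
      (\<bar>(1 + 2 * \<sigma> * real n) ^ \<beta> - 1\<bar> / (2 * real n)) ^ n * (2 ^ (\<beta> - 1) / real \<beta>) * P"
  shows "t = 2 ^ (\<beta> * (n + 1)) / (2 * real \<beta>)\<^sup>2 * real n ^ (\<beta> * n - 2) *
    (1 + \<sigma> / (2 * real n)) ^ (\<beta> * n) * \<bar>\<sigma> ^ \<beta> - (2 * real n + \<sigma>) powi (- int \<beta>)\<bar> ^ n * P"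
proof -
  define z where "z = 2 * real n + \<sigma>"
  define E where "E = \<bar>\<sigma> ^ \<beta> - z powi (- int \<beta>)\<bar>"
  define w where "w = \<bar>(1 + 2 * \<sigma> * real n) ^ \<beta> - 1\<bar>"
  have z: "z > 0"
    using \<sigma> n by (auto simp: z_def)
  have nz: "real n \<noteq> 0" "real \<beta> \<noteq> 0"
    using n \<beta> by auto
  have "z ^ \<beta> * E = \<bar>z ^ \<beta> * (\<sigma> ^ \<beta> - inverse (z ^ \<beta>))\<bar>"
    using z by (simp add: E_def abs_mult power_int_minus)
  also have "z ^ \<beta> * (\<sigma> ^ \<beta> - inverse (z ^ \<beta>)) = (\<sigma> * z) ^ \<beta> - 1"
    using z by (simp add: power_mult_distrib algebra_simps)
  also have "\<sigma> * z = 1 + 2 * \<sigma> * real n"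
    using \<sigma> by (auto simp: z_def)
  finally have w: "z ^ \<beta> * E = w"
    by (simp add: w_def)
  have "1 + \<sigma> / (2 * real n) = z / (2 * real n)"
    using nz by (simp add: z_def field_simps)
  then have "2 ^ (\<beta> * n) * real n ^ (\<beta> * n) * (1 + \<sigma> / (2 * real n)) ^ (\<beta> * n) * E ^ n = (z ^ \<beta> * E) ^ n"
    using nz by (simp add: power_mult_distrib power_divide power_mult)
  then have wn: "2 ^ (\<beta> * n) * real n ^ (\<beta> * n) * (1 + \<sigma> / (2 * real n)) ^ (\<beta> * n) * E ^ n = w ^ n"
    unfolding w .
  \<comment> \<open>Ensures that the subtraction in the exponent \<open>\<beta> * n - 2\<close> is
    not truncated.\<close>
  have "3 * 1 \<le> \<beta> * n"
    using \<beta> n by (intro mult_le_mono)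
  then have "\<beta> * n = (\<beta> * n - 2) + 2"
    by simp
  then have n2: "real n ^ (\<beta> * n) = real n ^ (\<beta> * n - 2) * (real n)\<^sup>2"
    by (metis power_add)
  have "(2 * real n) ^ n = (2 * real n) ^ (n - 1) * (2 * real n)" "2 ^ \<beta> = 2 ^ (\<beta> - 1) * (2 :: real)"
    using n \<beta> power_minus_mult[of n "2 * real n"] power_minus_mult[of \<beta> "2 :: real"] by simp_all
  then have "real (\<beta> * n) * t = w ^ n * 2 ^ \<beta> / (4 * real n * real \<beta>) * P"
    unfolding t w_def[symmetric] power_divide using nz by simp
  then have "t = 2 ^ \<beta> * w ^ n / (2 * real \<beta> * real n)\<^sup>2 * P"
    using nz by (simp add: field_simps power2_eq_square)
  also have "\<dots> = 2 ^ (\<beta> * (n + 1)) / (2 * real \<beta>)\<^sup>2 * real n ^ (\<beta> * n - 2) *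
    (1 + \<sigma> / (2 * real n)) ^ (\<beta> * n) * E ^ n * P"
    unfolding wn[symmetric] n2 using nz by (simp add: field_simps power_add power_mult_distrib)
  finally show ?thesis
    by (simp add: E_def z_def)
qed

theorem theorem3p1:
  fixes \<beta> n :: nat and \<mu> :: "nat \<Rightarrow> real"
  assumes "\<beta> \<ge> 2" and "n \<ge> 1"
    and "\<And>k. k \<in> {1..\<beta> - 1} \<Longrightarrow> \<mu> k = cycle_eigenvalue \<beta> k"
  shows
    "(\<beta> \<ge> 3 \<longrightarrow>
        real (\<tau> (power_graph n (\<beta> * n))) =
          2 ^ (\<beta> * (n + 1)) / (2 * real \<beta>)\<^sup>2 * real n ^ (\<beta> * n - 2)
          * (1 + 1 / (2 * real n)) ^ (\<beta> * n)
          * (1 - (2 * real n + 1) powi (- int \<beta>)) ^ n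
          * (\<Prod>k = 1..nat \<lceil>real \<beta> / 2\<rceil> - 1.
               (sin (pi * (real n + 1) * real k / real \<beta>
                 - real n * arcsin ((real n + 1)
                     / sqrt (4 * (real n)\<^sup>2 / \<mu> k + 2 * real n + 1))))\<^sup>2))
     \<and> (\<beta> = 2 \<longrightarrow>
        real (\<tau> (power_graph n (2 * n))) =
          (2 * real n) ^ (2 * n - 2) * (1 + 1 / real n) ^ n)
     \<and> (\<beta> \<ge> 3 \<longrightarrow>
        real (\<tau> (power_graph (n - 1) (\<beta> * n))) =
          2 ^ (\<beta> * (n + 1)) / (2 * real \<beta>)\<^sup>2 * real n ^ (\<beta> * n - 2)
          * (1 - 1 / (2 * real n)) ^ (\<beta> * n)
          * \<bar>(- 1) ^ \<beta> - (2 * real n - 1) powi (- int \<beta>)\<bar> ^ n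
          * (\<Prod>k = 1..nat \<lceil>real \<beta> / 2\<rceil> - 1.
               (sin (pi * (real n - 1) * real k / real \<beta>
                 - real n * arcsin ((real n - 1)
                     / sqrt (4 * (real n)\<^sup>2 / \<mu> k - (2 * real n - 1)))))\<^sup>2))
     \<and> (\<beta> = 2 \<longrightarrow>
        real (\<tau> (power_graph (n - 1) (2 * n))) =
          (2 * real n) ^ (2 * n - 2) * (1 - 1 / real n) ^ n)"
proof -
  note n = \<open>n \<ge> 1\<close>
  have r: "2 * real n + 1 = 2 * real n + 1" "2 * real (n - 1) + 1 = 2 * real n + - 1"
    using n by (simp_all add: of_nat_diff)
  have \<mu>: "\<mu> k = cycle_eigenvalue \<beta> k" if "k \<in> {1..(\<beta> - 1) div 2}" for k
    using that by (intro assms(3)) auto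
  have plus: "real (\<tau> (power_graph n (\<beta> * n))) =
          2 ^ (\<beta> * (n + 1)) / (2 * real \<beta>)\<^sup>2 * real n ^ (\<beta> * n - 2)
          * (1 + 1 / (2 * real n)) ^ (\<beta> * n)
          * (1 - (2 * real n + 1) powi (- int \<beta>)) ^ n
          * (\<Prod>k = 1..nat \<lceil>real \<beta> / 2\<rceil> - 1.
               (sin (pi * (real n + 1) * real k / real \<beta>
                 - real n * arcsin ((real n + 1)
                     / sqrt (4 * (real n)\<^sup>2 / \<mu> k + 2 * real n + 1))))\<^sup>2)"
    if "\<beta> \<ge> 3"
  proof -
    have "1 \<le> (2 * real n + 1) ^ \<beta>"
      by (rule one_le_power) simp
    then have "\<bar>1 ^ \<beta> - (2 * real n + 1) powi (- int \<beta>)\<bar> = 1 - (2 * real n + 1) powi (- int \<beta>)"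
      by (simp add: power_int_minus inverse_le_1_iff)
    moreover have "(sin (pi * real k / real \<beta> + 1 * real n * (pi * real k / real \<beta> -
          arcsin ((real n + 1) / sqrt (4 * (real n)\<^sup>2 / cycle_eigenvalue \<beta> k + 1 * (2 * real n + 1))))))\<^sup>2 =
        (sin (pi * (real n + 1) * real k / real \<beta> - real n * arcsin ((real n + 1)
          / sqrt (4 * (real n)\<^sup>2 / \<mu> k + 2 * real n + 1))))\<^sup>2" if "k \<in> {1..(\<beta> - 1) div 2}" for k
    proof -
      have "pi * real k / real \<beta> + 1 * real n * (pi * real k / real \<beta> - a) =
          pi * (real n + 1) * real k / real \<beta> - real n * a" for a
        by (simp add: algebra_simps add_divide_distrib)
      then show ?thesis
        unfolding \<mu>[OF that] by (simp add: add.assoc)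
    qed
    ultimately show ?thesis
      using closed_form_normalize[OF that n _ \<tau>_power_graph_closed_form[OF \<open>\<beta> \<ge> 2\<close> n _ r(1)]]
      unfolding ceiling_half by simp
  qed
  have minus: "real (\<tau> (power_graph (n - 1) (\<beta> * n))) =
          2 ^ (\<beta> * (n + 1)) / (2 * real \<beta>)\<^sup>2 * real n ^ (\<beta> * n - 2)
          * (1 - 1 / (2 * real n)) ^ (\<beta> * n)
          * \<bar>(- 1) ^ \<beta> - (2 * real n - 1) powi (- int \<beta>)\<bar> ^ n
          * (\<Prod>k = 1..nat \<lceil>real \<beta> / 2\<rceil> - 1.
               (sin (pi * (real n - 1) * real k / real \<beta>
                 - real n * arcsin ((real n - 1)
                     / sqrt (4 * (real n)\<^sup>2 / \<mu> k - (2 * real n - 1)))))\<^sup>2)"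
    if "\<beta> \<ge> 3"
  proof -
    have "(sin (pi * real k / real \<beta> + - 1 * real n * (pi * real k / real \<beta> -
          arcsin ((real n + - 1) / sqrt (4 * (real n)\<^sup>2 / cycle_eigenvalue \<beta> k + - 1 * (2 * real n + - 1))))))\<^sup>2 =
        (sin (pi * (real n - 1) * real k / real \<beta> - real n * arcsin ((real n - 1)
          / sqrt (4 * (real n)\<^sup>2 / \<mu> k - (2 * real n - 1)))))\<^sup>2" if "k \<in> {1..(\<beta> - 1) div 2}" for k
    proof -
      \<comment> \<open>For \<open>\<sigma> = -1\<close> the argument is the negative of the stated
        one; the square of the sine absorbs the sign.\<close>
      have "pi * real k / real \<beta> + - 1 * real n * (pi * real k / real \<beta> - a) =
          - (pi * (real n - 1) * real k / real \<beta> - real n * a)" for a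
        by (simp add: algebra_simps diff_divide_distrib)
      moreover have "c + - 1 * (2 * real n + - 1) = c - (2 * real n - 1)" for c
        by simp
      ultimately show ?thesis
        unfolding \<mu>[OF that] by (simp only: sin_minus power2_minus add_uminus_conv_diff)
    qed
    then have "(\<Prod>k = 1..(\<beta> - 1) div 2. (sin (pi * real k / real \<beta> + - 1 * real n * (pi * real k / real \<beta> -
          arcsin ((real n + - 1) / sqrt (4 * (real n)\<^sup>2 / cycle_eigenvalue \<beta> k + - 1 * (2 * real n + - 1))))))\<^sup>2) =
        (\<Prod>k = 1..nat \<lceil>real \<beta> / 2\<rceil> - 1. (sin (pi * (real n - 1) * real k / real \<beta> - real n * arcsin ((real n - 1)
          / sqrt (4 * (real n)\<^sup>2 / \<mu> k - (2 * real n - 1)))))\<^sup>2)"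
      unfolding ceiling_half by (rule prod.cong[OF refl])
    moreover have "1 + - 1 / (2 * real n) = 1 - 1 / (2 * real n)" "2 * real n + - 1 = 2 * real n - 1"
      by simp_all
    ultimately show ?thesis
      using closed_form_normalize[OF that n _ \<tau>_power_graph_closed_form[OF \<open>\<beta> \<ge> 2\<close> n _ r(2)]]
      by (simp only: simp_thms)
  qed
  \<comment> \<open>For \<open>\<beta> = 2\<close> the product of sines is empty, and
    \<open>(1 + 2 * \<sigma> * n)\<^sup>2 - 1 = 4 * n * (n + \<sigma>)\<close>.\<close>
  have two: "real (\<tau> (power_graph r (2 * n))) = (2 * real n) ^ (2 * n - 2) * (1 + \<sigma> / real n) ^ n"
    if "2 * real r + 1 = 2 * real n + \<sigma>" "\<sigma> = 1 \<or> \<sigma> = -1" for r \<sigma>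
  proof -
    define a where "a = 2 * real n"
    have a: "a \<noteq> 0"
      using n by (simp add: a_def)
    have "\<bar>(1 + 2 * \<sigma> * real n)\<^sup>2 - 1\<bar> = a * (a * (1 + \<sigma> / real n))"
      using that(2) n by (auto simp: a_def power2_eq_square algebra_simps)
    then have "a * real (\<tau> (power_graph r (2 * n))) = a ^ (n - 1) * (a * (1 + \<sigma> / real n)) ^ n"
      using \<tau>_power_graph_closed_form[OF _ n that(2,1), of 2] a by (simp add: a_def power_mult_distrib)
    also have "\<dots> = a * (a ^ (2 * n - 2) * (1 + \<sigma> / real n) ^ n)"
    proof -
      have "n - 1 + n = Suc (2 * n - 2)"
        using n by simp
      then have "a ^ (n - 1) * a ^ n = a * a ^ (2 * n - 2)"
        by (simp only: power_add[symmetric] power_Suc[symmetric])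
      then show ?thesis
        by (simp add: power_mult_distrib)
    qed
    finally show ?thesis
      using a by (simp add: a_def)
  qed
  show ?thesis
    using plus minus two[OF r(1)] two[OF r(2)] by simp
qed

end
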